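(* Let $\Delta$ be of type $A_n$ and let $\mathfrak{Ab}$ be its poset of abelian ideals. Then (i) $\mathcal K^{u}_{\mathfrak{Ab}}(q)=\sum_{k\ge0}\binom{n+1}{2k}q^k$; (ii) $\mathcal K^{l}_{\mathfrak{Ab}}(q)=\sum_{k\ge0}\big(\binom{n}{2k+1}+\binom{n}{2k-2}\big)q^k$; (iii) $D_{\mathfrak{Ab}}(q)=-\sum_{k\ge0}\binom{n-1}{2k+1}q^k$.
   Context: Type $A_n$: positive roots $\Delta^+=\{\varepsilon_i-\varepsilon_j:1\le i<j\le n+1\}$, simple roots $\varepsilon_i-\varepsilon_{i+1}$, with the root order (the partial order generated by $\gamma$ covering $\mu$ iff $\gamma-\mu$ is a simple root). An upper ideal $I\subset\Delta^+$ (up-closed subset) is abelian if $\gamma'+\gamma''\notin\Delta^+$ for all $\gamma',\gamma''\in I$; $\mathfrak{Ab}$ is the poset of all abelian upper ideals (including $\varnothing$) ordered by inclusion. For a finite poset $\mathcal P$, $\kappa(x)$ (resp. $\iota(x)$) is the number of elements covered by (resp. covering) $x$; $\mathcal K^{u}_{\mathcal P}=\sum_x q^{\kappa(x)}$, $\mathcal K^{l}_{\mathcal P}=\sum_x q^{\iota(x)}$, and $D_{\mathcal P}$ is defined by $\mathcal K^{u}_{\mathcal P}-\mathcal K^{l}_{\mathcal P}=(q-1)^2D_{\mathcal P}$. Binomial coefficients with negative lower index are $0$. *)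

theory Defs
  imports "HOL-Computational_Algebra.Polynomial" "HOL-Library.Poly_Mapping"
begin

section \<open>Covering polynomials of a finite poset\<close>

text \<open>A finite poset is a finite subset \<open>P\<close> of an ordered type, with the induced order.
  \<open>covers P x y\<close> reads: \<open>x\<close> covers \<open>y\<close> in \<open>P\<close>.\<close>

definition covers :: "'a::order set \<Rightarrow> 'a \<Rightarrow> 'a \<Rightarrow> bool" where
  "covers P x y \<longleftrightarrow> x \<in> P \<and> y \<in> P \<and> y < x \<and> \<not> (\<exists>z\<in>P. y < z \<and> z < x)"

definition kappa :: "'a::order set \<Rightarrow> 'a \<Rightarrow> nat" where
  "kappa P x = card {y \<in> P. covers P x y}"

definition iota :: "'a::order set \<Rightarrow> 'a \<Rightarrow> nat" where
  "iota P x = card {y \<in> P. covers P y x}"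

definition K_upper :: "'a::order set \<Rightarrow> int poly" where
  "K_upper P = (\<Sum>x\<in>P. monom 1 (kappa P x))"

definition K_lower :: "'a::order set \<Rightarrow> int poly" where
  "K_lower P = (\<Sum>x\<in>P. monom 1 (iota P x))"

text \<open>The polynomial \<open>[:-1, 1:]\<close> is \<open>q - 1\<close>. The description below is proper for finite \<open>P\<close>,
  by \<open>D_poly_unique_exists\<close>.\<close>

definition D_poly :: "'a::order set \<Rightarrow> int poly" where
  "D_poly P = (THE D. K_upper P - K_lower P = [:-1, 1:] ^ 2 * D)"

lemma sum_kappa_eq_sum_iota:
  assumes "finite P"
  shows "(\<Sum>x\<in>P. kappa P x) = (\<Sum>x\<in>P. iota P x)"
proof -
  have "(\<Sum>x\<in>P. kappa P x) = (\<Sum>x\<in>P. \<Sum>y | y \<in> P \<and> covers P x y. 1)"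
    by (simp add: kappa_def)
  also have "\<dots> = (\<Sum>y\<in>P. \<Sum>x | x \<in> P \<and> covers P x y. 1)"
    using assms by (rule sum.swap_restrict[OF _ assms])
  also have "\<dots> = (\<Sum>x\<in>P. iota P x)"
    by (simp add: iota_def)
  finally show ?thesis .
qed

lemma D_poly_unique_exists:
  assumes "finite P"
  shows "\<exists>!D. K_upper P - K_lower P = [:-1, 1:] ^ 2 * D"
proof -
  define p where "p = K_upper P - K_lower P"
  have "poly p 1 = 0"
    by (simp add: p_def K_upper_def K_lower_def poly_sum poly_monom)
  then have "[:-1, 1:] dvd p"
    by (simp add: poly_eq_0_iff_dvd)
  then obtain r where r: "p = [:-1, 1:] * r" ..
  have "poly (pderiv p) 1 = 0"
    using arg_cong[OF sum_kappa_eq_sum_iota[OF assms], of int]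
    by (simp add: p_def K_upper_def K_lower_def pderiv_diff pderiv_monom
        higher_pderiv_sum[where n = 1, simplified] poly_sum poly_monom)
  moreover have "poly (pderiv p) 1 = poly r 1"
    unfolding r pderiv_mult by (simp add: pderiv_pCons)
  ultimately have "[:-1, 1:] dvd r"
    by (simp add: poly_eq_0_iff_dvd)
  then obtain s where s: "r = [:-1, 1:] * s" ..
  have "p = [:-1, 1:] ^ 2 * s"
    unfolding r s power2_eq_square by (simp only: mult.assoc)
  then show ?thesis
    unfolding p_def[symmetric] by (intro ex1I[of _ s]) auto
qed

section \<open>Abelian ideals in type A\<close>

text \<open>Roots live in the integer span of \<open>\<epsilon>\<^sub>1, \<dots>, \<epsilon>\<^sub>n\<^sub>+\<^sub>1\<close>, represented by finitely supported
  functions; differences and sums of roots are those of this lattice.\<close>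

type_synonym weight = "nat \<Rightarrow>\<^sub>0 int"

definition eps :: "nat \<Rightarrow> weight" where
  "eps i = Poly_Mapping.single i 1"

definition positive_roots :: "nat \<Rightarrow> weight set" where
  "positive_roots n = {eps i - eps j | i j. 1 \<le> i \<and> i < j \<and> j \<le> n + 1}"

definition simple_roots :: "nat \<Rightarrow> weight set" where
  "simple_roots n = {eps i - eps (i + 1) | i. 1 \<le> i \<and> i \<le> n}"

definition root_covers :: "nat \<Rightarrow> weight \<Rightarrow> weight \<Rightarrow> bool" where
  "root_covers n \<gamma> \<mu> \<longleftrightarrow>
     \<gamma> \<in> positive_roots n \<and> \<mu> \<in> positive_roots n \<and> \<gamma> - \<mu> \<in> simple_roots n"

definition root_le :: "nat \<Rightarrow> weight \<Rightarrow> weight \<Rightarrow> bool" where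
  "root_le n = (\<lambda>\<mu> \<gamma>. root_covers n \<gamma> \<mu>)\<^sup>*\<^sup>*"

definition upper_ideal :: "nat \<Rightarrow> weight set \<Rightarrow> bool" where
  "upper_ideal n I \<longleftrightarrow> I \<subseteq> positive_roots n \<and>
     (\<forall>\<mu>\<in>I. \<forall>\<gamma>\<in>positive_roots n. root_le n \<mu> \<gamma> \<longrightarrow> \<gamma> \<in> I)"

definition abelian :: "nat \<Rightarrow> weight set \<Rightarrow> bool" where
  "abelian n I \<longleftrightarrow> (\<forall>\<gamma>'\<in>I. \<forall>\<gamma>''\<in>I. \<gamma>' + \<gamma>'' \<notin> positive_roots n)"

definition Ab :: "nat \<Rightarrow> weight set set" where
  "Ab n = {I. upper_ideal n I \<and> abelian n I}"

lemma finite_Ab: "finite (Ab n)"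
proof -
  have "positive_roots n \<subseteq> (\<lambda>(i, j). eps i - eps j) ` ({..n + 1} \<times> {..n + 1})"
    by (force simp: positive_roots_def)
  then have "finite (positive_roots n)"
    by (rule finite_subset) simp
  moreover have "Ab n \<subseteq> Pow (positive_roots n)"
    by (auto simp: Ab_def upper_ideal_def)
  ultimately show ?thesis
    by (meson finite_Pow_iff finite_subset)
qed

text \<open>Binomial coefficient with an integer lower index, zero if that index is negative. (With
  natural numbers, \<open>2 * k - 2\<close> would be \<open>0\<close> at \<open>k = 0\<close>.)\<close>

definition binom :: "nat \<Rightarrow> int \<Rightarrow> int" where
  "binom n k = (if k < 0 then 0 else int (n choose nat k))"

end

theory Submission imports Defs begin

text \<open>Identify the root \<open>\<epsilon>\<^sub>a - \<epsilon>\<^sub>b\<close> with the interval \<open>[a, b]\<close>. Minimal elements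
  of an abelian ideal have pairwise distinct endpoints, and every left endpoint lies strictly below
  every right endpoint; so an ideal with \<open>k\<close> minimal elements amounts to a set \<open>S \<subseteq> {1..n + 1}\<close>
  of size \<open>2 * k\<close>, and it consists of the intervals containing more than half of \<open>S\<close>. This gives
  the upper polynomial. Roots that can be added to the ideal of \<open>S\<close> correspond to intervals
  \<open>[x + 1, y - 1]\<close> where \<open>(x, y)\<close> is one of the \<open>k + 1\<close> minimal intervals for the enlarged
  set \<open>S \<union> {0, n + 2}\<close>. All of them may be added if the two middle elements of \<open>S\<close> are not
  adjacent; otherwise the two intervals with \<open>x = 0\<close> or \<open>y = n + 2\<close> would destroy
  abelianness. Summing over the position \<open>m\<close> of the lower middle element, there are
  \<open>\<Sum>m = 1..n. (m - 1 choose (k - 1)) * (n - m choose (k - 1)) = n choose (2 * k - 1)\<close>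
  sets with adjacent middle elements.\<close>

section \<open>Roots as intervals\<close>

definition root_pairs :: "nat \<Rightarrow> (nat \<times> nat) set" where
  "root_pairs n = {(a, b). 1 \<le> a \<and> a < b \<and> b \<le> n + 1}"

definition pair_root :: "nat \<times> nat \<Rightarrow> weight" where
  "pair_root p = eps (fst p) - eps (snd p)"

text \<open>The root order turns into inclusion of intervals, the larger root being the longer
  interval. Two positive roots add up to a root only when one interval ends where the other begins,
  so the last clause is abelianness.\<close>

definition pair_ideals :: "nat \<Rightarrow> (nat \<times> nat) set set" where
  "pair_ideals n = {I. I \<subseteq> root_pairs n \<and>
     (\<forall>a b c d. (a, b) \<in> I \<longrightarrow> 1 \<le> c \<longrightarrow> c \<le> a \<longrightarrow> b \<le> d \<longrightarrow> d \<le> n + 1 \<longrightarrow> (c, d) \<in> I) \<and>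
     (\<forall>a b c. (a, b) \<in> I \<longrightarrow> (b, c) \<notin> I)}"

lemma lookup_eps: "Poly_Mapping.lookup (eps i) k = (if i = k then 1 else 0)"
  by (simp add: eps_def lookup_single when_def)

lemma lookup_pair_root:
  "Poly_Mapping.lookup (pair_root (a, b)) k = (if a = k then 1 else 0) - (if b = k then 1 else 0)"
  by (simp add: pair_root_def lookup_minus lookup_eps)

text \<open>The left end carries coefficient 1 and the right end -1; equal ends would give the zero
  weight and hide both.\<close>

lemma pair_root_eqD:
  assumes "pair_root (a, b) = pair_root (c, d)" "a \<noteq> b"
  shows "a = c" "b = d"
proof -
  have *: "Poly_Mapping.lookup (pair_root (a, b)) k = Poly_Mapping.lookup (pair_root (c, d)) k" for k
    by (simp add: assms)
  show "a = c" "b = d"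
    using *[of a] *[of b] assms(2) by (auto simp: lookup_pair_root split: if_splits)
qed

lemma inj_on_pair_root: "inj_on pair_root (root_pairs n)"
  by (rule inj_onI) (auto simp: root_pairs_def dest: pair_root_eqD)

lemma positive_roots_eq: "positive_roots n = pair_root ` root_pairs n"
  by (force simp: positive_roots_def root_pairs_def pair_root_def)

lemma pair_root_in_positive_roots:
  "a \<noteq> b \<Longrightarrow> pair_root (a, b) \<in> positive_roots n \<longleftrightarrow> (a, b) \<in> root_pairs n"
  unfolding positive_roots_eq by (auto dest: pair_root_eqD)

lemma pair_root_add_positive_iff:
  assumes "(a, b) \<in> root_pairs n" "(c, d) \<in> root_pairs n"
  shows "pair_root (a, b) + pair_root (c, d) \<in> positive_roots n \<longleftrightarrow> b = c \<or> d = a"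
proof
  assume "pair_root (a, b) + pair_root (c, d) \<in> positive_roots n"
  then obtain i j where ij: "i < j" "pair_root (a, b) + pair_root (c, d) = pair_root (i, j)"
    by (auto simp: positive_roots_eq root_pairs_def)
  have *: "Poly_Mapping.lookup (pair_root (a, b)) k + Poly_Mapping.lookup (pair_root (c, d)) k
      = Poly_Mapping.lookup (pair_root (i, j)) k" for k
    by (metis ij(2) lookup_add)
  \<comment> \<open>A positive root has a single positive coefficient, and it is 1. If neither left
    end \<open>a\<close> nor \<open>c\<close> were cancelled, the sum would have two positive
    coefficients, or a 2 when \<open>a = c\<close>.\<close>
  show "b = c \<or> d = a"
    using *[of a] *[of c] assms ij(1)
    by (auto simp: lookup_pair_root root_pairs_def split: if_splits)
next
  have "pair_root (a, b) + pair_root (b, d) \<in> positive_roots n"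
    if "(a, b) \<in> root_pairs n" "(b, d) \<in> root_pairs n" for a b d
    using that pair_root_in_positive_roots[of a d n]
    by (auto simp: pair_root_def root_pairs_def)
  from this[of a b d] this[of c d b] assms
  show "b = c \<or> d = a \<Longrightarrow> pair_root (a, b) + pair_root (c, d) \<in> positive_roots n"
    by (auto simp: add.commute)
qed

lemma root_covers_pair_root_iff:
  assumes "(a, b) \<in> root_pairs n" "(c, d) \<in> root_pairs n"
  shows "root_covers n (pair_root (c, d)) (pair_root (a, b)) \<longleftrightarrow>
    (c + 1 = a \<and> b = d) \<or> (c = a \<and> b + 1 = d)"
proof
  assume "root_covers n (pair_root (c, d)) (pair_root (a, b))"
  then obtain i where i: "pair_root (c, d) - pair_root (a, b) = pair_root (i, i + 1)"
    by (auto simp: root_covers_def simple_roots_def pair_root_def)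
  have ne: "a \<noteq> b" "c \<noteq> d" "a < b" "c < d"
    using assms by (auto simp: root_pairs_def)
  consider "c = a" | "d = b" | "c \<noteq> a" "d \<noteq> b"
    by blast
  then show "(c + 1 = a \<and> b = d) \<or> (c = a \<and> b + 1 = d)"
  proof cases
    case 1
    with i have "pair_root (i, i + 1) = pair_root (b, d)"
      by (simp add: pair_root_def)
    then show ?thesis
      using 1 pair_root_eqD by fastforce
  next
    case 2
    with i have "pair_root (i, i + 1) = pair_root (c, a)"
      by (simp add: pair_root_def)
    then show ?thesis
      using 2 pair_root_eqD by fastforce
  next
    case 3
    have *: "Poly_Mapping.lookup (pair_root (c, d)) k - Poly_Mapping.lookup (pair_root (a, b)) k
        = Poly_Mapping.lookup (pair_root (i, i + 1)) k" for k
      by (metis i lookup_minus)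
    \<comment> \<open>Without a common end, the left end \<open>c\<close> of the minuend and the
      right end \<open>b\<close> of the subtrahend both have positive coefficient in the difference,
      so both equal \<open>i\<close>. The coefficient there is then 2, too large for a simple
      root.\<close>
    have "i = c"
      using *[of c] 3 ne by (auto simp: lookup_pair_root split: if_splits)
    moreover have "i = b"
      using *[of b] 3 ne by (auto simp: lookup_pair_root split: if_splits)
    ultimately show ?thesis
      using *[of c] 3 ne by (auto simp: lookup_pair_root)
  qed
next
  assume "(c + 1 = a \<and> b = d) \<or> (c = a \<and> b + 1 = d)"
  then have "pair_root (c, d) - pair_root (a, b) \<in> simple_roots n"
    using assms by (auto simp: simple_roots_def pair_root_def root_pairs_def)
  then show "root_covers n (pair_root (c, d)) (pair_root (a, b))"
    using assms by (auto simp: root_covers_def positive_roots_eq)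
qed

text \<open>Each cover lengthens the interval by one at one end, so only larger intervals can be
  reached. Conversely, a chain of covers moves the left end from \<open>a\<close> down to
  \<open>c\<close> and then the right end from \<open>b\<close> up to \<open>d\<close>.\<close>

lemma root_le_pair_root_iff:
  assumes "(a, b) \<in> root_pairs n" "(c, d) \<in> root_pairs n"
  shows "root_le n (pair_root (a, b)) (pair_root (c, d)) \<longleftrightarrow> c \<le> a \<and> b \<le> d"
proof
  have "\<exists>c d. (c, d) \<in> root_pairs n \<and> \<gamma> = pair_root (c, d) \<and> c \<le> a \<and> b \<le> d"
    if "root_le n (pair_root (a, b)) \<gamma>" for \<gamma>
    using that unfolding root_le_def
  proof (induction rule: rtranclp_induct)
    case base
    then show ?case using assms(1) by blast
  next
    case (step \<mu> \<gamma>)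
    from step.IH obtain c d where cd: "(c, d) \<in> root_pairs n" "\<mu> = pair_root (c, d)" "c \<le> a" "b \<le> d"
      by blast
    from step.hyps obtain u v where uv: "(u, v) \<in> root_pairs n" "\<gamma> = pair_root (u, v)"
      by (auto simp: root_covers_def positive_roots_eq)
    have "(u + 1 = c \<and> d = v) \<or> (u = c \<and> d + 1 = v)"
      using step.hyps(2) root_covers_pair_root_iff[OF cd(1) uv(1)] by (simp add: cd uv)
    then show ?case using cd uv by (intro exI[of _ u] exI[of _ v]) auto
  qed
  then show "root_le n (pair_root (a, b)) (pair_root (c, d)) \<Longrightarrow> c \<le> a \<and> b \<le> d"
    using assms(2) by (fastforce simp: root_pairs_def dest: pair_root_eqD)
next
  assume le: "c \<le> a \<and> b \<le> d"
  have 1: "root_le n (pair_root (a, b)) (pair_root (c, b))"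
    using le[THEN conjunct1]
  proof (induction rule: inc_induct)
    case (step i)
    have "root_covers n (pair_root (i, b)) (pair_root (Suc i, b))"
      using assms step.hyps by (subst root_covers_pair_root_iff) (auto simp: root_pairs_def)
    with step.IH show ?case
      unfolding root_le_def by (rule rtranclp.rtrancl_into_rtrancl)
  qed (simp add: root_le_def)
  have 2: "root_le n (pair_root (c, b)) (pair_root (c, d))"
    using le[THEN conjunct2]
  proof (induction rule: dec_induct)
    case (step j)
    have "root_covers n (pair_root (c, Suc j)) (pair_root (c, j))"
      using assms step.hyps le by (subst root_covers_pair_root_iff) (auto simp: root_pairs_def)
    with step.IH show ?case
      unfolding root_le_def by (rule rtranclp.rtrancl_into_rtrancl)
  qed (simp add: root_le_def)
  show "root_le n (pair_root (a, b)) (pair_root (c, d))"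
    using 1 2 by (simp add: root_le_def)
qed

lemma pair_root_image_in_Ab_iff:
  assumes I: "I \<subseteq> root_pairs n"
  shows "pair_root ` I \<in> Ab n \<longleftrightarrow> I \<in> pair_ideals n"
proof -
  have mem: "pair_root p \<in> pair_root ` I \<longleftrightarrow> p \<in> I" if "p \<in> root_pairs n" for p
    using inj_on_image_mem_iff[OF inj_on_pair_root that I] .
  have "upper_ideal n (pair_root ` I) \<longleftrightarrow>
      (\<forall>p\<in>I. \<forall>q\<in>root_pairs n. root_le n (pair_root p) (pair_root q) \<longrightarrow> pair_root q \<in> pair_root ` I)"
    using I by (auto simp: upper_ideal_def positive_roots_eq)
  also have "\<dots> \<longleftrightarrow> (\<forall>p\<in>I. \<forall>q\<in>root_pairs n. fst q \<le> fst p \<and> snd p \<le> snd q \<longrightarrow> q \<in> I)"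
  proof (intro ball_cong refl)
    fix p q assume "p \<in> I" and q: "q \<in> root_pairs n"
    with I have p: "p \<in> root_pairs n"
      by blast
    show "(root_le n (pair_root p) (pair_root q) \<longrightarrow> pair_root q \<in> pair_root ` I) \<longleftrightarrow>
        (fst q \<le> fst p \<and> snd p \<le> snd q \<longrightarrow> q \<in> I)"
      unfolding mem[OF q] using root_le_pair_root_iff[of "fst p" "snd p" n "fst q" "snd q"] p q by simp
  qed
  also have "\<dots> \<longleftrightarrow> (\<forall>a b c d. (a, b) \<in> I \<longrightarrow> 1 \<le> c \<longrightarrow> c \<le> a \<longrightarrow> b \<le> d \<longrightarrow> d \<le> n + 1 \<longrightarrow> (c, d) \<in> I)"
  proof (intro iffI allI impI)
    fix a b c d
    assume *: "\<forall>p\<in>I. \<forall>q\<in>root_pairs n. fst q \<le> fst p \<and> snd p \<le> snd q \<longrightarrow> q \<in> I"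
      and cd: "(a, b) \<in> I" "1 \<le> c" "c \<le> a" "b \<le> d" "d \<le> n + 1"
    with I have "(c, d) \<in> root_pairs n"
      by (auto simp: root_pairs_def)
    then show "(c, d) \<in> I"
      using *[rule_format, of "(a, b)" "(c, d)"] cd by simp
  next
    assume "\<forall>a b c d. (a, b) \<in> I \<longrightarrow> 1 \<le> c \<longrightarrow> c \<le> a \<longrightarrow> b \<le> d \<longrightarrow> d \<le> n + 1 \<longrightarrow> (c, d) \<in> I"
    then show "\<forall>p\<in>I. \<forall>q\<in>root_pairs n. fst q \<le> fst p \<and> snd p \<le> snd q \<longrightarrow> q \<in> I"
      by (auto simp: root_pairs_def)
  qed
  finally have upper: "upper_ideal n (pair_root ` I) \<longleftrightarrow> \<dots>" .
  have "abelian n (pair_root ` I) \<longleftrightarrow>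
      (\<forall>p\<in>I. \<forall>q\<in>I. pair_root p + pair_root q \<notin> positive_roots n)"
    by (simp add: abelian_def)
  also have "\<dots> \<longleftrightarrow> (\<forall>p\<in>I. \<forall>q\<in>I. \<not> (snd p = fst q \<or> snd q = fst p))"
  proof (intro ball_cong refl)
    fix p q assume "p \<in> I" "q \<in> I"
    with I have "p \<in> root_pairs n" "q \<in> root_pairs n"
      by blast+
    then show "pair_root p + pair_root q \<notin> positive_roots n \<longleftrightarrow> \<not> (snd p = fst q \<or> snd q = fst p)"
      using pair_root_add_positive_iff[of "fst p" "snd p" n "fst q" "snd q"] by simp
  qed
  also have "\<dots> \<longleftrightarrow> (\<forall>a b c. (a, b) \<in> I \<longrightarrow> (b, c) \<notin> I)"
    by fastforce
  finally show ?thesis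
    using upper I by (simp add: Ab_def pair_ideals_def)
qed

lemma Ab_eq_image: "Ab n = (`) pair_root ` pair_ideals n"
proof (intro equalityI subsetI)
  fix J assume J: "J \<in> Ab n"
  then have "J \<subseteq> pair_root ` root_pairs n"
    by (simp add: Ab_def upper_ideal_def positive_roots_eq)
  then obtain I where "I \<subseteq> root_pairs n" "J = pair_root ` I"
    by (metis subset_image_iff)
  with J show "J \<in> (`) pair_root ` pair_ideals n"
    by (auto simp: pair_root_image_in_Ab_iff)
next
  fix J assume "J \<in> (`) pair_root ` pair_ideals n"
  then show "J \<in> Ab n"
    using pair_root_image_in_Ab_iff by (auto simp: pair_ideals_def)
qed

section \<open>Transport of covering polynomials along an order embedding\<close>

lemma pair_ideals_less_iff:
  assumes "I \<in> pair_ideals n" "J \<in> pair_ideals n"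
  shows "pair_root ` I < pair_root ` J \<longleftrightarrow> I < J"
proof -
  have "I \<subseteq> root_pairs n" "J \<subseteq> root_pairs n"
    using assms by (auto simp: pair_ideals_def)
  then have "pair_root ` X \<subseteq> pair_root ` Y \<longleftrightarrow> X \<subseteq> Y" if "X \<in> {I, J}" "Y \<in> {I, J}" for X Y
    using that inj_on_image_mem_iff[OF inj_on_pair_root[of n]]
    by (smt (verit, best) image_mono image_subset_iff insertE singletonD subset_iff)
  then show ?thesis
    by (simp add: less_le_not_le)
qed

context
  fixes f :: "'a::order \<Rightarrow> 'b::order" and P :: "'a set"
  assumes inj: "inj_on f P"
    and less: "\<And>x y. x \<in> P \<Longrightarrow> y \<in> P \<Longrightarrow> f x < f y \<longleftrightarrow> x < y"
begin

lemma covers_image_iff: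
  assumes "x \<in> P" "y \<in> P"
  shows "covers (f ` P) (f x) (f y) \<longleftrightarrow> covers P x y"
  using assms by (auto simp: covers_def less)

lemma kappa_image:
  assumes "x \<in> P"
  shows "kappa (f ` P) (f x) = kappa P x"
proof -
  have "{z \<in> f ` P. covers (f ` P) (f x) z} = f ` {y \<in> P. covers P x y}"
    using assms covers_image_iff by auto
  then show ?thesis
    unfolding kappa_def by (metis (no_types, lifting) card_image inj inj_on_subset mem_Collect_eq subsetI)
qed

lemma iota_image:
  assumes "x \<in> P"
  shows "iota (f ` P) (f x) = iota P x"
proof -
  have "{z \<in> f ` P. covers (f ` P) z (f x)} = f ` {y \<in> P. covers P y x}"
    using assms covers_image_iff by auto
  then show ?thesis
    unfolding iota_def by (metis (no_types, lifting) card_image inj inj_on_subset mem_Collect_eq subsetI)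
qed

lemma K_upper_image: "K_upper (f ` P) = (\<Sum>x\<in>P. monom 1 (kappa P x))"
  unfolding K_upper_def by (simp add: sum.reindex[OF inj] kappa_image)

lemma K_lower_image: "K_lower (f ` P) = (\<Sum>x\<in>P. monom 1 (iota P x))"
  unfolding K_lower_def by (simp add: sum.reindex[OF inj] iota_image)

end

lemma inj_on_image_pair_root: "inj_on ((`) pair_root) (pair_ideals n)"
  by (rule inj_on_subset[OF inj_on_image_Pow[OF inj_on_pair_root[of n]]]) (auto simp: pair_ideals_def)

lemma K_upper_Ab: "K_upper (Ab n) = K_upper (pair_ideals n)"
  unfolding Ab_eq_image K_upper_def[of "pair_ideals n"]
  by (rule K_upper_image) (auto simp: inj_on_image_pair_root pair_ideals_less_iff)

lemma K_lower_Ab: "K_lower (Ab n) = K_lower (pair_ideals n)"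
  unfolding Ab_eq_image K_lower_def[of "pair_ideals n"]
  by (rule K_lower_image) (auto simp: inj_on_image_pair_root pair_ideals_less_iff)

section \<open>Covers by removing or inserting an interval\<close>

text \<open>Under the assumption \<open>rem\<close>, every smaller member \<open>J\<close> lies in
  some member \<open>I - {p}\<close>, so a covered \<open>J\<close> must equal it. Conversely no set
  fits strictly between \<open>I - {p}\<close> and \<open>I\<close>. The count of covered members
  becomes a count of removable elements.\<close>

lemma kappa_family:
  assumes I: "I \<in> F"
    and rem: "\<And>J. J \<in> F \<Longrightarrow> J \<subset> I \<Longrightarrow> \<exists>p\<in>I - J. I - {p} \<in> F"
  shows "kappa F I = card {p \<in> I. I - {p} \<in> F}"
proof -
  have "covers F I J \<longleftrightarrow> (\<exists>p\<in>I. I - {p} \<in> F \<and> J = I - {p})" if J: "J \<in> F" for J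
  proof
    assume c: "covers F I J"
    then obtain p where p: "p \<in> I - J" "I - {p} \<in> F"
      using rem[OF J] by (auto simp: covers_def)
    then have "\<not> J < I - {p}"
      using c by (auto simp: covers_def)
    then show "\<exists>p\<in>I. I - {p} \<in> F \<and> J = I - {p}"
      using p c by (auto simp: covers_def)
  qed (use I in \<open>auto simp: covers_def\<close>)
  then have "{J \<in> F. covers F I J} = (\<lambda>p. I - {p}) ` {p \<in> I. I - {p} \<in> F}"
    by auto
  moreover have "inj_on (\<lambda>p. I - {p}) {p \<in> I. I - {p} \<in> F}"
    by (rule inj_onI) auto
  ultimately show ?thesis
    by (simp add: kappa_def card_image)
qed

lemma iota_family:
  assumes I: "I \<in> F"
    and ins: "\<And>J. J \<in> F \<Longrightarrow> I \<subset> J \<Longrightarrow> \<exists>p\<in>J - I. insert p I \<in> F"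
  shows "iota F I = card {p. p \<notin> I \<and> insert p I \<in> F}"
proof -
  have "covers F J I \<longleftrightarrow> (\<exists>p. p \<notin> I \<and> insert p I \<in> F \<and> J = insert p I)" if J: "J \<in> F" for J
  proof
    assume c: "covers F J I"
    then obtain p where p: "p \<in> J - I" "insert p I \<in> F"
      using ins[OF J] by (auto simp: covers_def)
    then have "\<not> insert p I < J"
      using c by (auto simp: covers_def)
    then show "\<exists>p. p \<notin> I \<and> insert p I \<in> F \<and> J = insert p I"
      using p c by (auto simp: covers_def)
  qed (use I in \<open>auto simp: covers_def\<close>)
  then have "{J \<in> F. covers F J I} = (\<lambda>p. insert p I) ` {p. p \<notin> I \<and> insert p I \<in> F}"
    by auto
  moreover have "inj_on (\<lambda>p. insert p I) {p. p \<notin> I \<and> insert p I \<in> F}"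
    by (rule inj_onI) auto
  ultimately show ?thesis
    by (simp add: iota_def card_image)
qed

section \<open>Covering relations among ideals of intervals\<close>

lemma pair_idealsD:
  assumes "I \<in> pair_ideals n"
  shows "(a, b) \<in> I \<Longrightarrow> 1 \<le> a \<and> a < b \<and> b \<le> n + 1"
    and "(a, b) \<in> I \<Longrightarrow> 1 \<le> c \<Longrightarrow> c \<le> a \<Longrightarrow> b \<le> d \<Longrightarrow> d \<le> n + 1 \<Longrightarrow> (c, d) \<in> I"
    and "(a, b) \<in> I \<Longrightarrow> (b, c) \<notin> I"
  using assms unfolding pair_ideals_def root_pairs_def by blast+

text \<open>A shortest interval of \<open>I - J\<close> can be removed from \<open>I\<close>: any
  interval of \<open>I\<close> properly inside it is shorter, hence in \<open>J\<close>, and closure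
  of \<open>J\<close> would then put the removed interval into \<open>J\<close>.\<close>

lemma kappa_pair_ideals:
  assumes I: "I \<in> pair_ideals n"
  shows "kappa (pair_ideals n) I = card {p \<in> I. I - {p} \<in> pair_ideals n}"
proof (rule kappa_family[OF I])
  fix J assume J: "J \<in> pair_ideals n" "J \<subset> I"
  then obtain q where "q \<in> I - J" by blast
  from ex_has_least_nat[where P = "\<lambda>q. q \<in> I - J" and m = "\<lambda>(a, b). b - a", OF this]
  obtain u v where uv: "(u, v) \<in> I - J" and least: "\<And>a b. (a, b) \<in> I - J \<Longrightarrow> v - u \<le> b - a"
    by (auto split: prod.splits)
  have "(c, d) \<noteq> (u, v)"
    if "(a, b) \<in> I" "(a, b) \<noteq> (u, v)" "1 \<le> c" "c \<le> a" "b \<le> d" "d \<le> n + 1" for a b c d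
  proof
    assume eq: "(c, d) = (u, v)"
    then have "b - a < v - u"
      using that pair_idealsD(1)[OF I that(1)] by auto
    then have "(a, b) \<in> J"
      using least[of a b] that(1) by fastforce
    then have "(c, d) \<in> J"
      using pair_idealsD(2)[OF J(1)] that by blast
    then show False
      using uv eq by simp
  qed
  then have "I - {(u, v)} \<in> pair_ideals n"
    using I unfolding pair_ideals_def by blast
  then show "\<exists>p\<in>I - J. I - {p} \<in> pair_ideals n"
    using uv by blast
qed

text \<open>A longest interval of \<open>J - I\<close> can be added to \<open>I\<close>: the
  properly larger intervals lie in \<open>J\<close> by closure and then in \<open>I\<close> by
  maximality, while abelianness is inherited from \<open>J\<close>.\<close>

lemma iota_pair_ideals:
  assumes I: "I \<in> pair_ideals n"
  shows "iota (pair_ideals n) I = card {p. p \<notin> I \<and> insert p I \<in> pair_ideals n}"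
proof (rule iota_family[OF I])
  fix J assume J: "J \<in> pair_ideals n" "I \<subset> J"
  then obtain q where "q \<in> J - I" by blast
  \<comment> \<open>Subtracting the length from \<open>n + 1\<close> turns the longest interval into
    a minimum; lengths are at most \<open>n\<close>, so the subtraction does not truncate.\<close>
  from ex_has_least_nat[where P = "\<lambda>q. q \<in> J - I" and m = "\<lambda>(a, b). n + 1 - (b - a)", OF this]
  obtain u v where uv: "(u, v) \<in> J - I"
    and least: "\<And>a b. (a, b) \<in> J - I \<Longrightarrow> n + 1 - (v - u) \<le> n + 1 - (b - a)"
    by (auto split: prod.splits)
  have uv': "1 \<le> u \<and> u < v \<and> v \<le> n + 1"
    using uv pair_idealsD(1)[OF J(1)] by blast
  have up: "(c, d) \<in> I" if "1 \<le> c" "c \<le> u" "v \<le> d" "d \<le> n + 1" "(c, d) \<noteq> (u, v)" for c d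
  proof (rule ccontr)
    assume "(c, d) \<notin> I"
    moreover have "(c, d) \<in> J"
      using pair_idealsD(2)[OF J(1)] uv that by blast
    ultimately have "n + 1 - (v - u) \<le> n + 1 - (d - c)"
      using least by blast
    then show False
      using that uv' by auto
  qed
  have "insert (u, v) I \<in> pair_ideals n"
    unfolding pair_ideals_def
  proof (intro CollectI conjI allI impI)
    show "insert (u, v) I \<subseteq> root_pairs n"
      using uv' I by (auto simp: root_pairs_def pair_ideals_def)
  next
    fix a b c d
    assume "(a, b) \<in> insert (u, v) I" "1 \<le> c" "c \<le> a" "b \<le> d" "d \<le> n + 1"
    then show "(c, d) \<in> insert (u, v) I"
      using up pair_idealsD(2)[OF I] by blast
  next
    fix a b c
    assume "(a, b) \<in> insert (u, v) I"
    then show "(b, c) \<notin> insert (u, v) I"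
      using pair_idealsD(3)[OF J(1)] J(2) uv by blast
  qed
  then show "\<exists>p\<in>J - I. insert p I \<in> pair_ideals n"
    using uv by blast
qed

text \<open>Only the two intervals one step shorter need checking: every interval properly inside
  \<open>[u, v]\<close> lies in one of them, and closure then puts that one into
  \<open>I\<close>.\<close>

lemma remove_in_pair_ideals_iff:
  assumes I: "I \<in> pair_ideals n" and p: "(u, v) \<in> I"
  shows "I - {(u, v)} \<in> pair_ideals n \<longleftrightarrow> (u + 1, v) \<notin> I \<and> (u, v - 1) \<notin> I"
proof
  assume rem: "I - {(u, v)} \<in> pair_ideals n"
  have uv: "1 \<le> u \<and> u < v \<and> v \<le> n + 1"
    using p pair_idealsD(1)[OF I] by blast
  have "(u, v) \<in> I - {(u, v)}" if "(u + 1, v) \<in> I"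
    using pair_idealsD(2)[OF rem, of "u + 1" v u v] that uv by auto
  moreover have "(u, v) \<in> I - {(u, v)}" if "(u, v - 1) \<in> I"
    using pair_idealsD(2)[OF rem, of u "v - 1" u v] that uv by (cases v) auto
  ultimately show "(u + 1, v) \<notin> I \<and> (u, v - 1) \<notin> I"
    by blast
next
  assume not: "(u + 1, v) \<notin> I \<and> (u, v - 1) \<notin> I"
  have "(c, d) \<noteq> (u, v)"
    if "(a, b) \<in> I" "(a, b) \<noteq> (u, v)" "1 \<le> c" "c \<le> a" "b \<le> d" "d \<le> n + 1" for a b c d
  proof
    assume eq: "(c, d) = (u, v)"
    have "a \<noteq> u \<or> b \<noteq> v"
      using that(2) by blast
    moreover have "(u + 1, v) \<in> I" if "u < a"
      using that eq \<open>b \<le> d\<close> \<open>d \<le> n + 1\<close> by (intro pair_idealsD(2)[OF I \<open>(a, b) \<in> I\<close>]) auto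
    moreover have "(u, v - 1) \<in> I" if "b < v"
      using that eq \<open>1 \<le> c\<close> \<open>c \<le> a\<close> \<open>d \<le> n + 1\<close>
      by (intro pair_idealsD(2)[OF I \<open>(a, b) \<in> I\<close>]) auto
    ultimately show False
      using not eq that(4,5) by fastforce
  qed
  then show "I - {(u, v)} \<in> pair_ideals n"
    using I unfolding pair_ideals_def by blast
qed

section \<open>Intervals containing half of a set\<close>

lemma finite_nat_set_enumerate:
  fixes S :: "nat set"
  assumes "finite S"
  obtains e where "\<And>i j. j < card S \<Longrightarrow> i < j \<Longrightarrow> e i < e j" "S = e ` {..<card S}"
proof
  show "\<And>i j. j < card S \<Longrightarrow> i < j \<Longrightarrow> enumerate S i < enumerate S j"
    using assms by (simp add: finite_enumerate_mono)
  show "S = enumerate S ` {..<card S}"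
    using bij_betw_imp_surj_on[OF finite_bij_enumerate[OF assms]] by simp
qed

text \<open>In a set of size \<open>2 * k\<close>, these pair the \<open>s\<close>-th element with the \<open>(k + s)\<close>-th one.\<close>

definition half_pairs :: "nat set \<Rightarrow> (nat \<times> nat) set" where
  "half_pairs S = {(x, y). x \<in> S \<and> y \<in> S \<and> 2 * card (S \<inter> {x..y}) = card S + 2}"

text \<open>The interval from \<open>e s\<close> to \<open>e t\<close> contains
  \<open>t + 1 - s\<close> elements of \<open>S\<close>; asking for \<open>k + 1\<close> of them
  forces \<open>t = s + k\<close>.\<close>

lemma half_pairs_enumerate:
  fixes e :: "nat \<Rightarrow> nat"
  assumes S: "S = e ` {..<2 * k}" and mono: "\<And>i j. j < 2 * k \<Longrightarrow> i < j \<Longrightarrow> e i < e j"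
  shows "half_pairs S = (\<lambda>s. (e s, e (s + k))) ` {..<k}"
    and "inj_on e {..<2 * k}"
proof -
  have le_iff: "e i \<le> e j \<longleftrightarrow> i \<le> j" if "i < 2 * k" "j < 2 * k" for i j
    using mono[of i j] mono[of j i] that by (cases rule: linorder_cases[of i j]) auto
  show inj: "inj_on e {..<2 * k}"
    by (rule inj_onI) (metis antisym le_iff lessThan_iff order_refl)
  have card_S: "card S = 2 * k"
    using inj by (simp add: S card_image)
  have card_Int: "card (S \<inter> {e s..e t}) = t + 1 - s" if "s < 2 * k" "t < 2 * k" for s t
  proof -
    have "S \<inter> {e s..e t} = e ` {s..t}"
      using that by (auto simp: S le_iff)
    moreover have "inj_on e {s..t}"
      using that by (intro inj_on_subset[OF inj]) auto
    ultimately show ?thesis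
      by (simp add: card_image)
  qed
  show "half_pairs S = (\<lambda>s. (e s, e (s + k))) ` {..<k}"
  proof (intro equalityI subsetI)
    fix p assume "p \<in> half_pairs S"
    then obtain s t where st: "s < 2 * k" "t < 2 * k" "p = (e s, e t)"
        "2 * card (S \<inter> {e s..e t}) = card S + 2"
      unfolding half_pairs_def by (auto simp: S)
    then have "t = s + k" "s < k"
      using card_Int[of s t] by (auto simp: card_S)
    then show "p \<in> (\<lambda>s. (e s, e (s + k))) ` {..<k}"
      using st by auto
  next
    fix p assume "p \<in> (\<lambda>s. (e s, e (s + k))) ` {..<k}"
    then obtain s where s: "s < k" "p = (e s, e (s + k))"
      by auto
    then show "p \<in> half_pairs S"
      using card_Int[of s "s + k"] by (auto simp: half_pairs_def card_S) (auto simp: S)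
  qed
qed

text \<open>The left ends are the lower half of \<open>S\<close> and the right ends its upper half.
  Hence \<open>S\<close> can be read off from its half pairs, which later gives injectivity of
  \<open>set_ideal\<close>.\<close>

lemma
  assumes "finite S" "card S = 2 * k"
  shows card_half_pairs: "card (half_pairs S) = k"
    and half_pairs_endpoints: "fst ` half_pairs S \<union> snd ` half_pairs S = S"
proof -
  from finite_nat_set_enumerate[OF assms(1)]
  obtain e where mono: "\<And>i j. j < 2 * k \<Longrightarrow> i < j \<Longrightarrow> e i < e j" and S: "S = e ` {..<2 * k}"
    unfolding assms(2) by blast
  note hp = half_pairs_enumerate[OF S mono]
  have "inj_on (\<lambda>s. (e s, e (s + k))) {..<k}"
    using hp(2) by (auto simp: inj_on_def)
  then show "card (half_pairs S) = k"
    by (simp add: hp(1) card_image)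
  have "{..<2 * k} = {..<k} \<union> (\<lambda>s. s + k) ` {..<k}"
  proof (intro equalityI subsetI)
    fix s assume "s \<in> {..<2 * k}"
    then show "s \<in> {..<k} \<union> (\<lambda>s. s + k) ` {..<k}"
      by (cases "s < k") (auto intro!: image_eqI[of _ _ "s - k"])
  qed auto
  then have "S = e ` {..<k} \<union> e ` (\<lambda>s. s + k) ` {..<k}"
    using S by (metis image_Un)
  moreover have "fst ` half_pairs S = e ` {..<k}" "snd ` half_pairs S = e ` (\<lambda>s. s + k) ` {..<k}"
    by (simp_all add: hp(1) image_image)
  ultimately show "fst ` half_pairs S \<union> snd ` half_pairs S = S"
    by simp
qed

text \<open>In the enumeration of \<open>T\<close>, 0 has index 0 and \<open>n + 2\<close> has index
  \<open>2 * k + 1\<close>. Of the pairs with index \<open>s\<close> from 0 to \<open>k\<close>,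
  exactly the first and the last use these two. For \<open>k = 0\<close> they are the same pair, and
  the truncated \<open>k - 1\<close> is the correct value 0.\<close>

lemma card_half_pairs_inner:
  assumes S: "S \<subseteq> {1..n + 1}" and card_S: "card S = 2 * k"
  defines "T \<equiv> insert 0 (insert (n + 2) S)"
  shows "card (half_pairs T) = k + 1"
    and "card {(x, y) \<in> half_pairs T. x \<noteq> 0 \<and> y \<noteq> n + 2} = k - 1"
proof -
  have fin: "finite S"
    using S finite_subset by blast
  have "0 \<notin> S" "n + 2 \<notin> S"
    using S by auto
  then have card_T: "card T = 2 * (k + 1)"
    using fin card_S by (simp add: T_def)
  have finT: "finite T"
    using fin by (simp add: T_def)
  show "card (half_pairs T) = k + 1"
    using finT card_T by (rule card_half_pairs)
  from finite_nat_set_enumerate[OF finT]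
  obtain e where mono: "\<And>i j. j < 2 * (k + 1) \<Longrightarrow> i < j \<Longrightarrow> e i < e j" and T: "T = e ` {..<2 * (k + 1)}"
    unfolding card_T by blast
  note hp = half_pairs_enumerate[OF T mono]
  have "0 \<in> T" "n + 2 \<in> T"
    by (simp_all add: T_def)
  then obtain s t where s: "s < 2 * (k + 1)" "e s = 0" and t: "t < 2 * (k + 1)" "e t = n + 2"
    unfolding T by (elim imageE) simp
  have "s = 0"
    using mono[of s 0] s by (cases "s = 0") auto
  have "e (2 * k + 1) \<in> T"
    by (simp add: T)
  then have "e (2 * k + 1) \<le> n + 2"
    using S by (auto simp: T_def)
  then have "t = 2 * k + 1"
    using mono[of "2 * k + 1" t] t by (cases "t = 2 * k + 1") auto
  have e0: "e i = 0 \<longleftrightarrow> i = 0" if "i < 2 * (k + 1)" for i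
    using inj_onD[OF hp(2), of i s] that s \<open>s = 0\<close> by auto
  have e1: "e i = n + 2 \<longleftrightarrow> i = 2 * k + 1" if "i < 2 * (k + 1)" for i
    using inj_onD[OF hp(2), of i t] that t \<open>t = 2 * k + 1\<close> by auto
  have "{1..<k} = {s \<in> {..<k + 1}. e s \<noteq> 0 \<and> e (s + (k + 1)) \<noteq> n + 2}"
  proof (rule set_eqI)
    show "x \<in> {1..<k} \<longleftrightarrow> x \<in> {s \<in> {..<k + 1}. e s \<noteq> 0 \<and> e (s + (k + 1)) \<noteq> n + 2}" for x
      using e0[of x] e1[of "x + (k + 1)"] by (cases "x < k + 1") auto
  qed
  moreover have "{(x, y) \<in> half_pairs T. x \<noteq> 0 \<and> y \<noteq> n + 2} =
      (\<lambda>s. (e s, e (s + (k + 1)))) ` {s \<in> {..<k + 1}. e s \<noteq> 0 \<and> e (s + (k + 1)) \<noteq> n + 2}"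
    using hp(1) by auto
  ultimately have "{(x, y) \<in> half_pairs T. x \<noteq> 0 \<and> y \<noteq> n + 2} = (\<lambda>s. (e s, e (s + (k + 1)))) ` {1..<k}"
    by simp
  moreover have "inj_on (\<lambda>s. (e s, e (s + (k + 1)))) {1..<k}"
    using hp(2) by (auto simp: inj_on_def)
  ultimately show "card {(x, y) \<in> half_pairs T. x \<noteq> 0 \<and> y \<noteq> n + 2} = k - 1"
    by (simp add: card_image)
qed

section \<open>Abelian ideals as sets of even size\<close>

definition even_subsets :: "nat \<Rightarrow> nat set set" where
  "even_subsets n = {S. S \<subseteq> {1..n + 1} \<and> even (card S)}"

definition set_ideal :: "nat \<Rightarrow> nat set \<Rightarrow> (nat \<times> nat) set" where
  "set_ideal n S = {(a, b) \<in> root_pairs n. card S < 2 * card (S \<inter> {a..b})}"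

lemma even_subsetsE:
  assumes "S \<in> even_subsets n"
  obtains k where "finite S" "S \<subseteq> {1..n + 1}" "card S = 2 * k"
  using assms by (metis (mono_tags, lifting) even_subsets_def evenE finite_atLeastAtMost finite_subset mem_Collect_eq)

lemma card_Int_atLeastAtMost_mono:
  fixes S :: "nat set"
  assumes "finite S" "c \<le> a" "b \<le> d"
  shows "card (S \<inter> {a..b}) \<le> card (S \<inter> {c..d})"
  using assms by (intro card_mono) auto

lemma card_Int_adjacent_intervals:
  fixes S :: "nat set"
  assumes "finite S" "a \<le> b" "b \<le> c"
  shows "card (S \<inter> {a..b}) + card (S \<inter> {b..c}) = card (S \<inter> {a..c}) + card (S \<inter> {b})"
proof -
  have "S \<inter> {a..b} \<union> S \<inter> {b..c} = S \<inter> {a..c}" "(S \<inter> {a..b}) \<inter> (S \<inter> {b..c}) = S \<inter> {b}"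
    using assms by auto
  then show ?thesis
    using card_Un_Int[of "S \<inter> {a..b}" "S \<inter> {b..c}"] assms(1) by simp
qed

lemma less_if_card_Int_atLeastAtMost:
  fixes S :: "nat set"
  assumes "1 < card (S \<inter> {a..b})"
  shows "a < b"
proof (rule ccontr)
  assume "\<not> a < b"
  then have "S \<inter> {a..b} \<subseteq> {a}"
    by auto
  then have "card (S \<inter> {a..b}) \<le> 1"
    using card_mono[of "{a}"] by fastforce
  with assms show False
    by simp
qed

text \<open>Abelianness is a count: two intervals meeting in \<open>b\<close> would each contain at
  least \<open>k + 1\<close> elements of \<open>S\<close>, but together they contain at most
  \<open>2 * k\<close>, with only \<open>b\<close> counted twice. This uses that
  \<open>card S\<close> is even.\<close>

lemma set_ideal_in_pair_ideals:
  assumes "S \<in> even_subsets n"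
  shows "set_ideal n S \<in> pair_ideals n"
proof -
  from assms obtain k where fin: "finite S" and card_S: "card S = 2 * k"
    by (rule even_subsetsE)
  show ?thesis
    unfolding pair_ideals_def
  proof (intro CollectI conjI allI impI)
    fix a b c d
    assume "(a, b) \<in> set_ideal n S" "1 \<le> c" "c \<le> a" "b \<le> d" "d \<le> n + 1"
    then show "(c, d) \<in> set_ideal n S"
      using card_Int_atLeastAtMost_mono[OF fin, of c a b d] by (auto simp: set_ideal_def root_pairs_def)
  next
    fix a b c
    assume ab: "(a, b) \<in> set_ideal n S"
    show "(b, c) \<notin> set_ideal n S"
    proof
      assume bc: "(b, c) \<in> set_ideal n S"
      have "card (S \<inter> {a..c}) \<le> card S" "card (S \<inter> {b}) \<le> 1"
        using card_mono[OF fin, of "S \<inter> {a..c}"] card_mono[of "{b}" "S \<inter> {b}"] by simp_all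
      then show False
        using card_Int_adjacent_intervals[OF fin, of a b c] ab bc card_S
        by (auto simp: set_ideal_def root_pairs_def)
    qed
  qed (auto simp: set_ideal_def)
qed

text \<open>Minimality means that shortening at either end brings the count from above
  \<open>k\<close> down to at most \<open>k\<close>. This happens exactly when both ends belong to
  \<open>S\<close> and the count is \<open>k + 1\<close>.\<close>

lemma set_ideal_minimal:
  assumes S: "S \<in> even_subsets n"
  shows "{p \<in> set_ideal n S. set_ideal n S - {p} \<in> pair_ideals n} = half_pairs S"
proof -
  from S obtain k where fin: "finite S" and sub: "S \<subseteq> {1..n + 1}" and card_S: "card S = 2 * k"
    by (rule even_subsetsE)
  have "(a, b) \<in> set_ideal n S \<and> (a + 1, b) \<notin> set_ideal n S \<and> (a, b - 1) \<notin> set_ideal n S \<longleftrightarrow>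
      (a, b) \<in> half_pairs S" for a b
  proof
    assume *: "(a, b) \<in> set_ideal n S \<and> (a + 1, b) \<notin> set_ideal n S \<and> (a, b - 1) \<notin> set_ideal n S"
    then have ab: "1 \<le> a" "a < b" "b \<le> n + 1" and c: "k < card (S \<inter> {a..b})"
      by (auto simp: set_ideal_def root_pairs_def card_S)
    have "card (S \<inter> {a..b}) \<le> card S"
      using fin by (intro card_mono) auto
    with c have k: "1 \<le> k"
      by (simp add: card_S)
    \<comment> \<open>As \<open>k\<close> is at least 1, a count above \<open>k\<close> means two
      elements, so the shortened interval would still be a root and belong to the ideal.\<close>
    have c1: "card (S \<inter> {a + 1..b}) \<le> k"
    proof (rule ccontr)
      assume gt: "\<not> ?thesis"
      then have "a + 1 < b"
        using k less_if_card_Int_atLeastAtMost[of S "a + 1" b] by auto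
      then show False
        using * gt ab by (auto simp: set_ideal_def root_pairs_def card_S)
    qed
    have c2: "card (S \<inter> {a..b - 1}) \<le> k"
    proof (rule ccontr)
      assume gt: "\<not> ?thesis"
      then have "a < b - 1"
        using k less_if_card_Int_atLeastAtMost[of S a "b - 1"] by auto
      then show False
        using * gt ab by (auto simp: set_ideal_def root_pairs_def card_S)
    qed
    have "{a..b} = insert a {a + 1..b}" "{a..b} = insert b {a..b - 1}"
      using ab by auto
    then have ins: "S \<inter> {a..b} = (if a \<in> S then insert a (S \<inter> {a + 1..b}) else S \<inter> {a + 1..b})"
      "S \<inter> {a..b} = (if b \<in> S then insert b (S \<inter> {a..b - 1}) else S \<inter> {a..b - 1})"
      by auto
    have "a \<in> S"
      using ins(1) c c1 by (auto split: if_splits)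
    moreover have "b \<in> S"
      using ins(2) c c2 by (auto split: if_splits)
    moreover have "card (S \<inter> {a..b}) = k + 1"
      using ins(1) c c1 \<open>a \<in> S\<close> fin by auto
    ultimately show "(a, b) \<in> half_pairs S"
      by (simp add: half_pairs_def card_S)
  next
    assume "(a, b) \<in> half_pairs S"
    then have ab: "a \<in> S" "b \<in> S" "card (S \<inter> {a..b}) = k + 1"
      by (auto simp: half_pairs_def card_S)
    then have "card S \<noteq> 0"
      using fin by auto
    then have "1 \<le> k"
      by (simp add: card_S)
    then have "a < b"
      using ab(3) less_if_card_Int_atLeastAtMost[of S a b] by auto
    have "S \<inter> {a..b} = insert a (S \<inter> {a + 1..b})" "a \<notin> S \<inter> {a + 1..b}"
      using ab \<open>a < b\<close> by auto
    then have "card (S \<inter> {a..b}) = Suc (card (S \<inter> {a + 1..b}))"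
      using fin by simp
    moreover have "S \<inter> {a..b} = insert b (S \<inter> {a..b - 1})" "b \<notin> S \<inter> {a..b - 1}"
      using ab \<open>a < b\<close> by auto
    then have "card (S \<inter> {a..b}) = Suc (card (S \<inter> {a..b - 1}))"
      using fin by simp
    ultimately show "(a, b) \<in> set_ideal n S \<and> (a + 1, b) \<notin> set_ideal n S \<and> (a, b - 1) \<notin> set_ideal n S"
      using ab sub \<open>a < b\<close> by (auto simp: set_ideal_def root_pairs_def card_S)
  qed
  then show ?thesis
    using remove_in_pair_ideals_iff[OF set_ideal_in_pair_ideals[OF S]] by auto
qed

lemma kappa_set_ideal:
  assumes "S \<in> even_subsets n"
  shows "kappa (pair_ideals n) (set_ideal n S) = card S div 2"
proof -
  from assms obtain k where "finite S" "card S = 2 * k"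
    by (rule even_subsetsE)
  then show ?thesis
    using kappa_pair_ideals[OF set_ideal_in_pair_ideals[OF assms]]
    by (simp add: set_ideal_minimal[OF assms] card_half_pairs)
qed

text \<open>The ideal determines its minimal elements, which are the half pairs, and their endpoints
  make up the whole set.\<close>

lemma inj_on_set_ideal: "inj_on (set_ideal n) (even_subsets n)"
proof (rule inj_onI)
  fix S T assume S: "S \<in> even_subsets n" and T: "T \<in> even_subsets n"
    and eq: "set_ideal n S = set_ideal n T"
  have endpoints: "fst ` half_pairs X \<union> snd ` half_pairs X = X" if X: "X \<in> even_subsets n" for X
  proof -
    obtain k where "finite X" "card X = 2 * k"
      using X by (rule even_subsetsE)
    then show ?thesis
      by (rule half_pairs_endpoints)
  qed
  have "S = fst ` half_pairs S \<union> snd ` half_pairs S"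
    by (rule endpoints[OF S, symmetric])
  also have "half_pairs S = half_pairs T"
    unfolding set_ideal_minimal[OF S, symmetric] set_ideal_minimal[OF T, symmetric] eq ..
  also have "fst ` half_pairs T \<union> snd ` half_pairs T = T"
    by (rule endpoints[OF T])
  finally show "S = T" .
qed

section \<open>Recovering an even set from an arbitrary abelian ideal\<close>

lemma card_Int_less:
  assumes "finite (S \<inter> B)" "A \<subseteq> B" "x \<in> S" "x \<in> B" "x \<notin> A"
  shows "card (S \<inter> A) < card (S \<inter> B)"
proof (rule psubset_card_mono[OF assms(1)])
  have "x \<in> S \<inter> B" "x \<notin> S \<inter> A" "S \<inter> A \<subseteq> S \<inter> B"
    using assms by auto
  then show "S \<inter> A \<subset> S \<inter> B"
    by (metis psubsetI)
qed

text \<open>\<open>M\<close> consists of the minimal intervals and \<open>S\<close> of their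
  endpoints. Along the antichain \<open>M\<close> left and right ends increase together, and all
  left ends precede all right ends, so \<open>S\<close> has twice as many elements as
  \<open>M\<close>. Membership in \<open>I\<close> is then decided by counting endpoints.\<close>

lemma pair_ideal_eq_set_ideal:
  assumes I: "I \<in> pair_ideals n"
  obtains S where "S \<in> even_subsets n" "I = set_ideal n S"
proof -
  define M where "M = {p \<in> I. \<forall>q\<in>I. fst p \<le> fst q \<and> snd q \<le> snd p \<longrightarrow> q = p}"
  define S where "S = fst ` M \<union> snd ` M"
  have I_D: "1 \<le> fst p \<and> fst p < snd p \<and> snd p \<le> n + 1" if "p \<in> I" for p
    using pair_idealsD(1)[OF I, of "fst p" "snd p"] that by simp
  have "I \<subseteq> {..n + 1} \<times> {..n + 1}"
    using I_D by force
  then have finI: "finite I"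
    by (rule finite_subset) simp
  have MI: "M \<subseteq> I"
    by (auto simp: M_def)
  then have finM: "finite M"
    using finI finite_subset by blast
  have minimal: "q = p" if "p \<in> M" "q \<in> M" "fst p \<le> fst q" "snd q \<le> snd p" for p q
    using that by (auto simp: M_def)
  have mono: "fst p \<le> fst q \<longleftrightarrow> snd p \<le> snd q" if "p \<in> M" "q \<in> M" for p q
    using minimal[of p q] minimal[of q p] that by (metis nat_le_linear)
  have injs: "inj_on fst M" "inj_on snd M"
    using mono by (auto intro!: inj_onI prod_eqI simp: order_eq_iff)
  have below: "\<exists>p\<in>M. a \<le> fst p \<and> snd p \<le> b" if "(a, b) \<in> I" for a b
    using that
  proof (induction "b - a" arbitrary: a b rule: less_induct)
    case less
    show ?case
    proof (cases "(a, b) \<in> M")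
      case True
      then show ?thesis by force
    next
      case False
      then obtain q where "q \<in> I" "a \<le> fst q" "snd q \<le> b" "q \<noteq> (a, b)"
        using less.prems unfolding M_def by force
      then obtain c d where cd: "(c, d) \<in> I" "a \<le> c" "d \<le> b" "(c, d) \<noteq> (a, b)"
        by (metis prod.collapse)
      then have "d - c < b - a"
        using I_D[OF cd(1)] by auto
      from less.hyps[OF this cd(1)] show ?thesis
        using cd by (meson le_trans)
    qed
  qed
  \<comment> \<open>Otherwise \<open>q\<close> could be stretched within \<open>I\<close> until its
    right end is \<open>fst p\<close>, and it would meet \<open>p\<close> there, against
    abelianness.\<close>
  have sep: "fst p < snd q" if pq: "p \<in> M" "q \<in> M" for p q
  proof (rule ccontr)
    assume "\<not> fst p < snd q"
    moreover have "(fst p, snd p) \<in> I" "(fst q, snd q) \<in> I"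
      using pq MI by auto
    ultimately show False
      using pair_idealsD(2)[OF I, of "fst q" "snd q" "fst q" "fst p"]
        pair_idealsD(3)[OF I, of "fst q" "fst p" "snd p"] I_D[of "(fst p, snd p)"] I_D[of "(fst q, snd q)"]
      by (metis le_refl fst_conv snd_conv le_trans less_imp_le not_less)
  qed
  have S_sub: "S \<subseteq> {1..n + 1}"
    using I_D MI unfolding S_def by fastforce
  then have finS: "finite S"
    using finite_subset by blast
  have "fst ` M \<inter> snd ` M = {}"
    using sep by fastforce
  then have card_S: "card S = 2 * card M"
    using finM injs by (simp add: S_def card_Un_disjoint card_image)
  have card_sub: "card (fst ` X) = card X" "card (snd ` X) = card X" if "X \<subseteq> M" for X
    using injs that by (auto intro: card_image inj_on_subset)
  have "(a, b) \<in> I \<longleftrightarrow> (a, b) \<in> set_ideal n S" for a b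
  proof
    assume ab: "(a, b) \<in> I"
    then obtain p where p: "p \<in> M" "a \<le> fst p" "snd p \<le> b"
      using below by blast
    \<comment> \<open>The left ends of \<open>X\<close> and the right ends of \<open>Y\<close> all
      lie in \<open>[a, b]\<close> by \<open>sep\<close>. As \<open>X\<close> and \<open>Y\<close>
      cover \<open>M\<close> and share only \<open>p\<close>, this gives \<open>card M + 1\<close>
      endpoints, more than half of \<open>S\<close>.\<close>
    define X where "X = {q \<in> M. fst p \<le> fst q}"
    define Y where "Y = {q \<in> M. snd q \<le> snd p}"
    have "q \<in> X \<union> Y \<longleftrightarrow> q \<in> M" for q
      using mono[OF p(1), of q] nat_le_linear[of "snd p" "snd q"] unfolding X_def Y_def by blast
    moreover have "q \<in> X \<inter> Y \<longleftrightarrow> q = p" for q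
      using p(1) minimal[OF p(1), of q] unfolding X_def Y_def by blast
    ultimately have "X \<union> Y = M" "X \<inter> Y = {p}"
      by blast+
    then have card_XY: "card X + card Y = card M + 1"
      using card_Un_Int[of X Y] finM by (simp add: X_def Y_def)
    have "fst ` X \<inter> snd ` Y = {}"
      using sep by (fastforce simp: X_def Y_def)
    then have card_Un: "card (fst ` X \<union> snd ` Y) = card X + card Y"
      using card_sub[of X] card_sub[of Y] finM by (subst card_Un_disjoint) (auto simp: X_def Y_def)
    have "fst q \<in> S \<inter> {a..b}" if "q \<in> X" for q
      using that p sep[of q p] by (auto simp: X_def S_def)
    moreover have "snd q \<in> S \<inter> {a..b}" if "q \<in> Y" for q
      using that p sep[of p q] by (auto simp: Y_def S_def)
    ultimately have "fst ` X \<union> snd ` Y \<subseteq> S \<inter> {a..b}"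
      by blast
    then have "card (fst ` X \<union> snd ` Y) \<le> card (S \<inter> {a..b})"
      using finS by (intro card_mono) auto
    moreover have "(a, b) \<in> root_pairs n"
      using pair_idealsD(1)[OF I ab] by (simp add: root_pairs_def)
    ultimately show "(a, b) \<in> set_ideal n S"
      using card_XY card_Un by (simp add: set_ideal_def card_S)
  next
    assume ab: "(a, b) \<in> set_ideal n S"
    show "(a, b) \<in> I"
    proof (rule ccontr)
      assume notin: "(a, b) \<notin> I"
      \<comment> \<open>A member of both \<open>X\<close> and \<open>Y\<close> would be an interval
        of \<open>I\<close> inside \<open>[a, b]\<close> and force \<open>(a, b)\<close> into
        \<open>I\<close>. So the two are disjoint, and at most \<open>card M\<close> endpoints, half
        of \<open>S\<close>, lie in \<open>[a, b]\<close>.\<close>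
      define X where "X = {q \<in> M. a \<le> fst q}"
      define Y where "Y = {q \<in> M. snd q \<le> b}"
      have "q \<notin> Y" if "q \<in> X" for q
        using that notin pair_idealsD(2)[OF I, of "fst q" "snd q" a b] ab MI
        by (auto simp: X_def Y_def set_ideal_def root_pairs_def)
      then have "X \<inter> Y = {}" by blast
      then have "card X + card Y = card (X \<union> Y)"
        using finM by (subst card_Un_disjoint) (auto simp: X_def Y_def)
      also have "\<dots> \<le> card M"
        using finM by (intro card_mono) (auto simp: X_def Y_def)
      finally have "card X + card Y \<le> card M" .
      moreover have "S \<inter> {a..b} \<subseteq> fst ` X \<union> snd ` Y"
        by (auto simp: S_def X_def Y_def)
      then have "card (S \<inter> {a..b}) \<le> card (fst ` X \<union> snd ` Y)"
        using finM by (intro card_mono) (auto simp: X_def Y_def)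
      moreover have "card (fst ` X \<union> snd ` Y) \<le> card X + card Y"
        using card_Un_le[of "fst ` X" "snd ` Y"] card_sub[of X] card_sub[of Y]
        by (auto simp: X_def Y_def)
      ultimately show False
        using ab by (auto simp: set_ideal_def card_S)
    qed
  qed
  then have "I = set_ideal n S"
    by (auto intro: set_eqI)
  moreover have "S \<in> even_subsets n"
    using S_sub card_S by (simp add: even_subsets_def)
  ultimately show ?thesis
    using that by blast
qed

lemma pair_ideals_eq_image: "pair_ideals n = set_ideal n ` even_subsets n"
  using pair_ideal_eq_set_ideal set_ideal_in_pair_ideals by (metis (no_types, lifting) image_iff set_eqI)

section \<open>Upper covers\<close>

text \<open>For \<open>card S = 2 * k\<close> this makes \<open>m\<close> the \<open>k\<close>-th
  smallest element and \<open>Suc m\<close> the next one: the two middle elements are consecutive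
  integers. The empty set does not qualify.\<close>

definition central_adjacent :: "nat set \<Rightarrow> bool" where
  "central_adjacent S \<longleftrightarrow> (\<exists>m. m \<in> S \<and> Suc m \<in> S \<and> 2 * card (S \<inter> {..m}) = card S)"

text \<open>The points 0 and \<open>n + 2\<close> act as artificial members just outside the range.
  Stripping both ends of a half pair of the enlarged set leaves exactly half of \<open>S\<close> in
  the interior.\<close>

lemma mem_half_pairs_insert_iff:
  assumes S: "S \<subseteq> {1..n + 1}"
  shows "(x, y) \<in> half_pairs (insert 0 (insert (n + 2) S)) \<longleftrightarrow>
    x \<in> insert 0 S \<and> y \<in> insert (n + 2) S \<and> x < y \<and> 2 * card (S \<inter> {x + 1..y - 1}) = card S"
proof -
  define T where "T = insert 0 (insert (n + 2) S)"
  have fin: "finite S"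
    using S finite_subset by blast
  have "0 \<notin> S" "n + 2 \<notin> S"
    using S by auto
  then have card_T: "card T = card S + 2"
    using fin by (simp add: T_def)
  have le: "z \<le> n + 2" if "z \<in> T" for z
    using S that by (auto simp: T_def)
  have card_Int: "card (T \<inter> {x..y}) = card (S \<inter> {x + 1..y - 1}) + 2" if "x \<in> T" "y \<in> T" "x < y"
  proof -
    have "T \<inter> {x..y} = insert x (insert y (S \<inter> {x + 1..y - 1}))"
      using that le[OF that(1)] le[OF that(2)] by (auto simp: T_def)
    moreover have "x \<notin> insert y (S \<inter> {x + 1..y - 1})" "y \<notin> S \<inter> {x + 1..y - 1}"
      using that by auto
    ultimately show ?thesis
      using fin by (simp del: insert_iff)
  qed
  have "x < y" if "(x, y) \<in> half_pairs T"
    using that card_T less_if_card_Int_atLeastAtMost[of T x y] by (auto simp: half_pairs_def)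
  then have "(x, y) \<in> half_pairs T \<longleftrightarrow> x \<in> T \<and> y \<in> T \<and> x < y \<and> 2 * card (S \<inter> {x + 1..y - 1}) = card S"
    using card_Int card_T by (auto simp: half_pairs_def)
  also have "\<dots> \<longleftrightarrow> x \<in> insert 0 S \<and> y \<in> insert (n + 2) S \<and> x < y \<and> 2 * card (S \<inter> {x + 1..y - 1}) = card S"
    using le by (fastforce simp: T_def)
  finally show ?thesis
    by (simp add: T_def)
qed

text \<open>The new interval contains at most \<open>k\<close> elements of \<open>S\<close>, while
  every larger interval contains more. So one step outwards at either end must hit \<open>S\<close>,
  unless it leaves the range, where 0 or \<open>n + 2\<close> stands in.\<close>

lemma insert_in_pair_idealsD:
  assumes S: "finite S" "S \<subseteq> {1..n + 1}" and card_S: "card S = 2 * k"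
    and notin: "(a, b) \<notin> set_ideal n S" and J: "insert (a, b) (set_ideal n S) \<in> pair_ideals n"
  shows "1 \<le> a" "a < b" "b \<le> n + 1" "a - 1 \<in> insert 0 S" "b + 1 \<in> insert (n + 2) S"
    "card (S \<inter> {a..b}) = k" "central_adjacent S \<longrightarrow> a \<noteq> 1 \<and> b \<noteq> n + 1"
proof -
  show ab: "1 \<le> a" "a < b" "b \<le> n + 1"
    using pair_idealsD(1)[OF J, of a b] by auto
  have le: "card (S \<inter> {a..b}) \<le> k"
    using notin ab by (auto simp: set_ideal_def root_pairs_def card_S)
  have in_ideal: "k < card (S \<inter> {c..d})" if "1 \<le> c" "c \<le> a" "b \<le> d" "d \<le> n + 1" "c \<noteq> a \<or> d \<noteq> b" for c d
    using pair_idealsD(2)[OF J, of a b c d] that by (auto simp: set_ideal_def card_S)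
  have left: "a - 1 \<in> S \<and> card (S \<inter> {a..b}) = k" if "a \<noteq> 1"
  proof -
    have "{a - 1..b} = insert (a - 1) {a..b}"
      using ab by auto
    then have "S \<inter> {a - 1..b} = (if a - 1 \<in> S then insert (a - 1) (S \<inter> {a..b}) else S \<inter> {a..b})"
      by auto
    then show ?thesis
      using in_ideal[of "a - 1" b] that ab le S(1) by (cases a) (auto split: if_splits)
  qed
  have right: "b + 1 \<in> S \<and> card (S \<inter> {a..b}) = k" if "b \<noteq> n + 1"
  proof -
    have "{a..b + 1} = insert (b + 1) {a..b}"
      using ab by auto
    then have "S \<inter> {a..b + 1} = (if b + 1 \<in> S then insert (b + 1) (S \<inter> {a..b}) else S \<inter> {a..b})"
      by auto
    then show ?thesis
      using in_ideal[of a "b + 1"] that ab le S(1) by (auto split: if_splits)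
  qed
  show "a - 1 \<in> insert 0 S" "b + 1 \<in> insert (n + 2) S"
    using left right by fastforce+
  show k: "card (S \<inter> {a..b}) = k"
  proof (cases "a = 1 \<and> b = n + 1")
    \<comment> \<open>The full interval contains all \<open>2 * k\<close> elements but at most
      \<open>k\<close> of them, so \<open>k = 0\<close>.\<close>
    case True
    then have "S \<inter> {a..b} = S"
      using S by auto
    with le card_S show ?thesis by simp
  qed (use left right in auto)
  show "central_adjacent S \<longrightarrow> a \<noteq> 1 \<and> b \<noteq> n + 1"
  proof
    assume "central_adjacent S"
    then obtain m where m: "m \<in> S" "Suc m \<in> S" "card (S \<inter> {..m}) = k"
      by (auto simp: central_adjacent_def card_S)
    have mn: "1 \<le> m" "m < n + 1"
      using S m by auto
    have "S \<inter> {0..n + 1} = S" "S \<inter> {m} = {m}"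
      using S m by auto
    then have upper: "card (S \<inter> {m..n + 1}) = k + 1"
      using card_Int_adjacent_intervals[OF S(1), of 0 m "n + 1"] mn m
      by (simp add: card_S atLeast0AtMost)
    have "S \<inter> {m..n + 1} = insert m (S \<inter> {Suc m..n + 1})"
      using m mn by auto
    then have upper': "card (S \<inter> {Suc m..n + 1}) = k"
      using upper S(1) by simp
    have "S \<inter> {1..Suc m} = insert (Suc m) (S \<inter> {..m})"
      using m S by auto
    then have lower: "card (S \<inter> {1..Suc m}) = k + 1"
      using S(1) m(3) by simp
    \<comment> \<open>If \<open>a = 1\<close>, containing exactly \<open>k\<close> elements forces
      \<open>b = m\<close>, because \<open>m\<close> and \<open>Suc m\<close> both lie in
      \<open>S\<close>. Then \<open>(m, n + 1)\<close> has \<open>k + 1\<close> elements, is in the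
      ideal, and meets the new interval at \<open>m\<close>. The case \<open>b = n + 1\<close> is
      symmetric, with \<open>(1, Suc m)\<close>.\<close>
    have "a \<noteq> 1"
    proof
      assume [simp]: "a = 1"
      have S_b: "S \<inter> {a..b} = S \<inter> {..b}"
        using S by auto
      have "b = m"
      proof (rule ccontr)
        assume "b \<noteq> m"
        then consider "b < m" | "Suc m \<le> b"
          by linarith
        then show False
        proof cases
          case 1
          then have "card (S \<inter> {..b}) < card (S \<inter> {..m})"
            using m by (intro card_Int_less[of _ _ _ m]) auto
          then show ?thesis using m(3) k 1 S_b by simp
        next
          case 2
          then have "card (S \<inter> {..m}) < card (S \<inter> {..b})"
            using m by (intro card_Int_less[of _ _ _ "Suc m"]) auto
          then show ?thesis using m(3) k S_b by simp
        qed
      qed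
      then have "(b, n + 1) \<in> set_ideal n S"
        using mn upper by (auto simp: set_ideal_def root_pairs_def card_S)
      then show False
        using pair_idealsD(3)[OF J, of a b "n + 1"] by auto
    qed
    moreover have "b \<noteq> n + 1"
    proof
      assume [simp]: "b = n + 1"
      have "a = Suc m"
      proof (rule ccontr)
        assume "a \<noteq> Suc m"
        then consider "a \<le> m" | "Suc m < a"
          by linarith
        then show False
        proof cases
          case 1
          then have "card (S \<inter> {Suc m..n + 1}) < card (S \<inter> {a..n + 1})"
            using m mn by (intro card_Int_less[of _ _ _ m]) auto
          then show ?thesis using upper' k by simp
        next
          case 2
          then have "card (S \<inter> {a..n + 1}) < card (S \<inter> {Suc m..n + 1})"
            using m mn by (intro card_Int_less[of _ _ _ "Suc m"]) auto
          then show ?thesis using upper' k by simp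
        qed
      qed
      then have "(1, a) \<in> set_ideal n S"
        using mn lower by (auto simp: set_ideal_def root_pairs_def card_S)
      then show False
        using pair_idealsD(3)[OF J, of 1 a b] by auto
    qed
    ultimately show "a \<noteq> 1 \<and> b \<noteq> n + 1" ..
  qed
qed

text \<open>Closure is clear from the counts, since the neighbours of the new interval lie in
  \<open>S\<close> or out of range. What remains is that it is a genuine root and meets no interval
  of the ideal end to end; each failure would make the middle of \<open>S\<close> adjacent while
  \<open>x = 0\<close> or \<open>y = n + 2\<close>, or would contradict the counts.\<close>

lemma insert_in_pair_idealsI:
  assumes S: "finite S" "S \<subseteq> {1..n + 1}" and card_S: "card S = 2 * k" and n: "1 \<le> n"
    and x: "x \<in> insert 0 S" and y: "y \<in> insert (n + 2) S" and "x < y"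
    and k: "card (S \<inter> {x + 1..y - 1}) = k"
    and adj: "central_adjacent S \<longrightarrow> x \<noteq> 0 \<and> y \<noteq> n + 2"
  shows "(x + 1, y - 1) \<notin> set_ideal n S" "insert (x + 1, y - 1) (set_ideal n S) \<in> pair_ideals n"
proof -
  define a where "a = x + 1"
  define b where "b = y - 1"
  have xa: "x = a - 1" "1 \<le> a" and yb: "y = b + 1"
    using \<open>x < y\<close> by (simp_all add: a_def b_def)
  have k': "card (S \<inter> {a..b}) = k"
    using k by (simp add: a_def b_def)
  have "y \<le> n + 2"
    using y S by auto
  then have bn: "b \<le> n + 1"
    by (simp add: b_def)
  have S_even: "S \<in> even_subsets n"
    using S card_S by (simp add: even_subsets_def)
  note ideal = set_ideal_in_pair_ideals[OF S_even]
  show notin: "(x + 1, y - 1) \<notin> set_ideal n S"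
    using k by (simp add: set_ideal_def card_S)
  have adjI: "central_adjacent S" if "m \<in> S" "Suc m \<in> S" "card (S \<inter> {..m}) = k" for m
    using that by (auto simp: central_adjacent_def card_S)
  \<comment> \<open>For \<open>k = 0\<close> the pair is 0 and \<open>n + 2\<close>, and
    \<open>n \<ge> 1\<close> leaves enough room. Otherwise a degenerate interval is a single point
    of \<open>S\<close> and \<open>k = 1\<close>. Then \<open>S\<close> is this point and one
    neighbour, so its middle is adjacent and \<open>adj\<close> demands the other neighbour as a
    third element.\<close>
  have ab: "a < b"
  proof (rule ccontr)
    assume not: "\<not> a < b"
    show False
    proof (cases "k = 0")
      case True
      then have "S = {}"
        using S card_S by simp
      then show False
        using x y not n by (simp add: a_def b_def)
    next
      case False
      then have "S \<inter> {a..b} \<noteq> {}"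
        using k' by (metis card.empty)
      then obtain z where z: "z \<in> S" "a \<le> z" "z \<le> b"
        by auto
      then have [simp]: "b = a" and "z = a"
        using not by auto
      with z have "a \<in> S"
        by simp
      then have "k = 1"
        using k' by simp
      have S_eq: "S = {u, v}" if "u \<in> S" "v \<in> S" "u \<noteq> v" for u v
        using that S(1) card_S \<open>k = 1\<close> by (intro card_subset_eq[symmetric]) auto
      have y_eq: "y = a + 1"
        by (simp add: yb)
      show False
      proof (cases "x = 0")
        case True
        then have "a = 1"
          by (simp add: a_def)
        then have "y \<noteq> n + 2"
          using n y_eq by simp
        then have "y \<in> S"
          using y by simp
        then have "S = {a, y}"
          using \<open>a \<in> S\<close> y_eq by (intro S_eq) auto
        then have "S \<inter> {..a} = {a}"
          using y_eq by auto
        then have "central_adjacent S"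
          using \<open>a \<in> S\<close> \<open>y \<in> S\<close> \<open>k = 1\<close> y_eq by (intro adjI[of a]) auto
        with adj True show False
          by simp
      next
        case False
        then have "x \<in> S"
          using x by simp
        then have "S = {x, a}"
          using \<open>a \<in> S\<close> by (intro S_eq) (auto simp: a_def)
        then have "S \<inter> {..x} = {x}"
          by (auto simp: a_def)
        then have "central_adjacent S"
          using \<open>x \<in> S\<close> \<open>a \<in> S\<close> \<open>k = 1\<close> by (intro adjI[of x]) (auto simp: a_def)
        then have "y \<in> S"
          using adj y by auto
        then show False
          using \<open>S = {x, a}\<close> \<open>x < y\<close> y_eq by auto
      qed
    qed
  qed
  have up: "(c, d) \<in> set_ideal n S"
    if cd: "1 \<le> c" "c \<le> a" "b \<le> d" "d \<le> n + 1" "(c, d) \<noteq> (a, b)" for c d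
  proof -
    have "card (S \<inter> {a..b}) < card (S \<inter> {c..d})"
    proof (cases "c < a")
      case True
      then have "x \<in> S"
        using x cd by (auto simp: a_def)
      then show ?thesis
        using S cd True ab by (intro card_Int_less[of _ _ _ x]) (auto simp: a_def)
    next
      case False
      then have "b < d"
        using cd by auto
      then have "y \<in> S"
        using y cd by (auto simp: yb)
      then show ?thesis
        using S cd \<open>b < d\<close> ab by (intro card_Int_less[of _ _ _ y]) (auto simp: yb)
    qed
    then show ?thesis
      using cd ab by (auto simp: set_ideal_def root_pairs_def card_S k')
  qed
  \<comment> \<open>The counts \<open>k\<close> and at least \<open>k + 1\<close> sum to at most
    \<open>2 * k + 1\<close>, so equality holds: \<open>b\<close> is in \<open>S\<close>, and
    \<open>S\<close> starts no earlier than \<open>a\<close>. Then \<open>b\<close> and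
    \<open>y\<close> are the adjacent middle elements, and \<open>adj\<close> requires
    \<open>x\<close>, which is below \<open>a\<close>, to be in \<open>S\<close>.\<close>
  have right: "(b, w) \<notin> set_ideal n S" for w
  proof
    assume "(b, w) \<in> set_ideal n S"
    then have w: "b < w" "w \<le> n + 1" "k < card (S \<inter> {b..w})"
      by (auto simp: set_ideal_def root_pairs_def card_S)
    have "card (S \<inter> {b}) \<le> 1" "card (S \<inter> {a..w}) \<le> 2 * k"
      using card_mono[of "{b}" "S \<inter> {b}"] card_mono[OF S(1), of "S \<inter> {a..w}"] card_S by auto
    then have "card (S \<inter> {b}) = 1" "card (S \<inter> {a..w}) = card S"
      using card_Int_adjacent_intervals[OF S(1), of a b w] ab w k' card_S by linarith+
    then have "b \<in> S" "S \<inter> {a..w} = S"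
      using S(1) by (cases "b \<in> S", simp_all add: card_subset_eq)
    then have "S \<inter> {..b} = S \<inter> {a..b}"
      by auto
    moreover have "y \<in> S"
      using y w by (auto simp: yb)
    ultimately have "central_adjacent S"
      using \<open>b \<in> S\<close> k' by (intro adjI[of b]) (auto simp: yb)
    then have "x \<in> S"
      using adj x by auto
    then have "x \<in> {a..w}"
      using \<open>S \<inter> {a..w} = S\<close> by blast
    then show False
      by (simp add: a_def)
  qed
  have left: "(u, a) \<notin> set_ideal n S" for u
  proof
    assume "(u, a) \<in> set_ideal n S"
    then have u: "1 \<le> u" "u < a" "k < card (S \<inter> {u..a})"
      by (auto simp: set_ideal_def root_pairs_def card_S)
    have "card (S \<inter> {a}) \<le> 1" "card (S \<inter> {u..b}) \<le> 2 * k"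
      using card_mono[of "{a}" "S \<inter> {a}"] card_mono[OF S(1), of "S \<inter> {u..b}"] card_S by auto
    then have "card (S \<inter> {a}) = 1" "card (S \<inter> {u..b}) = card S" "card (S \<inter> {u..a}) = k + 1"
      using card_Int_adjacent_intervals[OF S(1), of u a b] ab u k' card_S by linarith+
    then have "a \<in> S" "S \<inter> {u..b} = S" and card_ua: "card (S \<inter> {u..a}) = k + 1"
      using S(1) by (cases "a \<in> S", simp_all add: card_subset_eq)
    have "z \<in> S \<inter> {u..a} \<longleftrightarrow> z \<in> insert a (S \<inter> {..x})" for z
    proof -
      have "u \<le> z" if "z \<in> S"
        using that \<open>S \<inter> {u..b} = S\<close> by (metis IntD2 atLeastAtMost_iff)
      then show ?thesis
        using u \<open>a \<in> S\<close> by (auto simp: a_def)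
    qed
    then have "S \<inter> {u..a} = insert a (S \<inter> {..x})"
      by blast
    moreover have "a \<notin> S \<inter> {..x}"
      by (simp add: a_def)
    ultimately have "card (S \<inter> {..x}) = k"
      using S(1) card_ua by simp
    moreover have "x \<in> S"
      using x u by (auto simp: a_def)
    ultimately have "central_adjacent S"
      using \<open>a \<in> S\<close> by (intro adjI[of x]) (auto simp: a_def)
    then have "y \<in> S"
      using adj y by auto
    then have "y \<in> {u..b}"
      using \<open>S \<inter> {u..b} = S\<close> by blast
    then show False
      by (simp add: yb)
  qed
  have "insert (a, b) (set_ideal n S) \<in> pair_ideals n"
    unfolding pair_ideals_def
  proof (intro CollectI conjI allI impI)
    show "insert (a, b) (set_ideal n S) \<subseteq> root_pairs n"
      using ab xa bn by (auto simp: root_pairs_def set_ideal_def)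
  next
    fix a' b' c d
    assume "(a', b') \<in> insert (a, b) (set_ideal n S)" "1 \<le> c" "c \<le> a'" "b' \<le> d" "d \<le> n + 1"
    then show "(c, d) \<in> insert (a, b) (set_ideal n S)"
      using up pair_idealsD(2)[OF ideal] by blast
  next
    fix u v w
    assume "(u, v) \<in> insert (a, b) (set_ideal n S)"
    then show "(v, w) \<notin> insert (a, b) (set_ideal n S)"
      using left right ab pair_idealsD(3)[OF ideal] by auto
  qed
  then show "insert (x + 1, y - 1) (set_ideal n S) \<in> pair_ideals n"
    by (simp add: a_def b_def)
qed

lemma iota_set_ideal:
  assumes S: "S \<in> even_subsets n" and n: "1 \<le> n"
  shows "iota (pair_ideals n) (set_ideal n S) =
    (if central_adjacent S then card S div 2 - 1 else card S div 2 + 1)"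
proof -
  from S obtain k where fin: "finite S" and sub: "S \<subseteq> {1..n + 1}" and card_S: "card S = 2 * k"
    by (rule even_subsetsE)
  define H where "H = half_pairs (insert 0 (insert (n + 2) S))"
  define Q where "Q = {(x, y) \<in> H. central_adjacent S \<longrightarrow> x \<noteq> 0 \<and> y \<noteq> n + 2}"
  note H_iff = mem_half_pairs_insert_iff[OF sub, folded H_def, unfolded card_S]
  have "{p. p \<notin> set_ideal n S \<and> insert p (set_ideal n S) \<in> pair_ideals n} = (\<lambda>(x, y). (x + 1, y - 1)) ` Q"
  proof (intro equalityI subsetI)
    fix p assume p: "p \<in> {p. p \<notin> set_ideal n S \<and> insert p (set_ideal n S) \<in> pair_ideals n}"
    obtain a b where [simp]: "p = (a, b)"
      by (cases p)
    have "(a, b) \<notin> set_ideal n S" "insert (a, b) (set_ideal n S) \<in> pair_ideals n"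
      using p by auto
    note D = insert_in_pair_idealsD[OF fin sub card_S this]
    have "(a - 1, b + 1) \<in> Q"
      using D by (auto simp: Q_def H_iff)
    then show "p \<in> (\<lambda>(x, y). (x + 1, y - 1)) ` Q"
      using D(1) by (intro image_eqI[of _ _ "(a - 1, b + 1)"]) auto
  next
    fix p assume "p \<in> (\<lambda>(x, y). (x + 1, y - 1)) ` Q"
    then obtain x y where xy: "(x, y) \<in> Q" and [simp]: "p = (x + 1, y - 1)"
      by auto
    have "(x, y) \<in> H" "central_adjacent S \<longrightarrow> x \<noteq> 0 \<and> y \<noteq> n + 2"
      using xy by (auto simp: Q_def)
    then show "p \<in> {p. p \<notin> set_ideal n S \<and> insert p (set_ideal n S) \<in> pair_ideals n}"
      using insert_in_pair_idealsI[OF fin sub card_S n, of x y] by (simp add: H_iff)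
  qed
  \<comment> \<open>The truncated \<open>y - 1\<close> loses nothing, since \<open>x < y\<close>
    keeps \<open>y\<close> positive.\<close>
  moreover have "inj_on (\<lambda>(x, y). (x + 1, y - 1)) Q"
  proof (rule inj_onI, clarify)
    fix x y x' y'
    assume Q: "(x, y) \<in> Q" "(x', y') \<in> Q" and eq: "x + 1 = x' + 1" "y - 1 = y' - 1"
    have "x < y" "x' < y'"
      using Q H_iff by (simp_all add: Q_def)
    with eq show "x = x' \<and> y = y'"
      by linarith
  qed
  ultimately have "iota (pair_ideals n) (set_ideal n S) = card Q"
    by (simp add: iota_pair_ideals[OF set_ideal_in_pair_ideals[OF S]] card_image)
  also have "card Q = (if central_adjacent S then k - 1 else k + 1)"
  proof (cases "central_adjacent S")
    case True
    then have "Q = {(x, y) \<in> H. x \<noteq> 0 \<and> y \<noteq> n + 2}"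
      by (simp add: Q_def)
    then show ?thesis
      using True card_half_pairs_inner(2)[OF sub card_S] by (simp add: H_def)
  next
    case False
    then have "Q = H"
      by (simp add: Q_def)
    then show ?thesis
      using False card_half_pairs_inner(1)[OF sub card_S] by (simp add: H_def)
  qed
  finally show ?thesis
    by (simp add: card_S)
qed

section \<open>Counting\<close>

text \<open>Subsets of size \<open>j + k + 1\<close> of \<open>{0..n}\<close> are sorted by the
  position \<open>m\<close> of their element number \<open>j + 1\<close>. The induction applies
  Pascal's rule to the second factor, so \<open>k\<close> must vary.\<close>

lemma sum_choose_mult_choose:
  "(\<Sum>m\<le>n. (m choose j) * ((n - m) choose k)) = Suc n choose (j + k + 1)"
proof (induction n arbitrary: k)
  case 0
  then show ?case
    by (cases j; cases k) auto
next
  case (Suc n)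
  show ?case
  proof (cases k)
    case 0
    then show ?thesis
      using sum_choose_upper[of j "Suc n"] by simp
  next
    case (Suc l)
    \<comment> \<open>The summand for \<open>m = Suc n\<close> vanishes because \<open>k\<close> is
      positive.\<close>
    have "(\<Sum>m\<le>Suc n. (m choose j) * ((Suc n - m) choose k)) =
        (\<Sum>m\<le>n. (m choose j) * (((n - m) choose l) + ((n - m) choose Suc l)))"
      by (auto simp: Suc Suc_diff_le intro!: sum.cong)
    also have "\<dots> = (Suc n choose (j + l + 1)) + (Suc n choose (j + Suc l + 1))"
      by (simp only: distrib_left sum.distrib Suc.IH)
    also have "\<dots> = Suc (Suc n) choose (j + k + 1)"
      by (simp add: Suc)
    finally show ?thesis .
  qed
qed

text \<open>Such a set splits uniquely into \<open>j\<close> elements below \<open>m\<close>, the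
  pair \<open>m\<close>, \<open>Suc m\<close>, and \<open>j\<close> elements above; \<open>F\<close>
  reassembles the triples collected in \<open>X\<close>.\<close>

lemma card_central_adjacent:
  "card {S. S \<subseteq> {1..n + 1} \<and> card S = 2 * (j + 1) \<and> central_adjacent S} = n choose (2 * j + 1)"
proof -
  define F where "F = (\<lambda>(m, A, B). A \<union> {m, Suc m} \<union> (B :: nat set))"
  define X where "X = (SIGMA m:{1..n}. {A. A \<subseteq> {1..<m} \<and> card A = j} \<times> {B. B \<subseteq> {m + 2..n + 1} \<and> card B = j})"
  have fin: "finite A" if "A \<subseteq> {a..b}" for A and a b :: nat
    using that finite_subset by blast
  have parts: "F (m, A, B) \<inter> {..<m} = A \<and> F (m, A, B) \<inter> {Suc (Suc m)..} = B \<and>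
      F (m, A, B) \<inter> {..m} = insert m A \<and> card (F (m, A, B) \<inter> {..m}) = j + 1 \<and>
      card (F (m, A, B)) = 2 * (j + 1)"
    if "(m, A, B) \<in> X" for m A B
  proof -
    have AB: "A \<subseteq> {1..<m}" "B \<subseteq> {m + 2..n + 1}" "card A = j" "card B = j"
      using that by (auto simp: X_def)
    have finAB: "finite A" "finite B"
      using AB finite_subset by blast+
    have "m \<notin> A" "Suc m \<notin> insert m A" "(A \<union> {m, Suc m}) \<inter> B = {}"
      using AB(1,2) by fastforce+
    then have "card (F (m, A, B)) = 2 * (j + 1)" "card (insert m A) = j + 1"
      using AB finAB by (simp_all add: F_def card_Un_disjoint)
    moreover have "F (m, A, B) \<inter> {..<m} = A" "F (m, A, B) \<inter> {Suc (Suc m)..} = B"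
      "F (m, A, B) \<inter> {..m} = insert m A"
      using AB by (auto simp: F_def)
    ultimately show ?thesis
      by simp
  qed
  have "inj_on F X"
  proof (rule inj_onI)
    fix p q assume pq: "p \<in> X" "q \<in> X" "F p = F q"
    obtain m A B m' A' B' where [simp]: "p = (m, A, B)" "q = (m', A', B')"
      by (metis prod_cases3)
    \<comment> \<open>The position \<open>m\<close> is determined by the set: both initial segments
      have \<open>j + 1\<close> elements, yet the longer one also contains
      \<open>m'\<close>.\<close>
    have lt: False if "(m, A, B) \<in> X" "(m', A', B') \<in> X" "F (m, A, B) = F (m', A', B')" "m < m'"
      for m A B m' A' B'
    proof -
      have "card (F (m', A', B') \<inter> {..m}) < card (F (m', A', B') \<inter> {..m'})"
        using that(4) by (intro card_Int_less[of _ _ _ m']) (auto simp: F_def)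
      moreover have "card (F (m, A, B) \<inter> {..m}) = j + 1" "card (F (m', A', B') \<inter> {..m'}) = j + 1"
        using parts[OF that(1)] parts[OF that(2)] by blast+
      ultimately show False
        unfolding that(3) by linarith
    qed
    have "m = m'"
      using lt[of m A B m' A' B'] lt[of m' A' B' m A B] pq by (cases rule: linorder_cases[of m m']) auto
    moreover have "A = F p \<inter> {..<m}" "B = F p \<inter> {Suc (Suc m)..}"
      "A' = F q \<inter> {..<m'}" "B' = F q \<inter> {Suc (Suc m')..}"
      using parts[OF pq(1)[unfolded \<open>p = _\<close>]] parts[OF pq(2)[unfolded \<open>q = _\<close>]] by simp_all
    ultimately have "A = A'" "B = B'"
      using pq(3) by metis+
    with \<open>m = m'\<close> show "p = q"
      by simp
  qed
  have "{S. S \<subseteq> {1..n + 1} \<and> card S = 2 * (j + 1) \<and> central_adjacent S} = F ` X"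
  proof (intro equalityI subsetI)
    fix S assume "S \<in> {S. S \<subseteq> {1..n + 1} \<and> card S = 2 * (j + 1) \<and> central_adjacent S}"
    then obtain m where S: "S \<subseteq> {1..n + 1}" "card S = 2 * (j + 1)"
      and m: "m \<in> S" "Suc m \<in> S" "card (S \<inter> {..m}) = j + 1"
      by (auto simp: central_adjacent_def)
    have finS: "finite S"
      using S fin by blast
    have S_eq: "S = S \<inter> {..<m} \<union> {m, Suc m} \<union> S \<inter> {m + 2..}"
      using m by auto
    have "S \<inter> {..m} = insert m (S \<inter> {..<m})"
      using m by auto
    then have cA: "card (S \<inter> {..<m}) = j"
      using m(3) by simp
    have "card S = card (S \<inter> {..<m} \<union> {m, Suc m}) + card (S \<inter> {m + 2..})"
      by (subst S_eq, subst card_Un_disjoint) (use finS in auto)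
    also have "card (S \<inter> {..<m} \<union> {m, Suc m}) = j + 2"
      by (subst card_Un_disjoint) (auto simp: cA)
    finally have cB: "card (S \<inter> {m + 2..}) = j"
      using S(2) by simp
    have "(m, S \<inter> {..<m}, S \<inter> {m + 2..}) \<in> X"
      using S(1) m cA cB by (auto simp: X_def)
    then show "S \<in> F ` X"
      by (rule image_eqI[rotated]) (unfold F_def prod.case, rule S_eq)
  next
    fix S assume "S \<in> F ` X"
    then obtain m A B where X: "(m, A, B) \<in> X" and S: "S = F (m, A, B)"
      by (metis imageE prod_cases3)
    have "m \<in> S" "Suc m \<in> S"
      by (auto simp: S F_def)
    moreover have "2 * card (S \<inter> {..m}) = card S"
      unfolding S using parts[OF X] by metis
    ultimately have "central_adjacent S"
      unfolding central_adjacent_def by blast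
    moreover have "S \<subseteq> {1..n + 1}"
      using X by (auto simp: S F_def X_def)
    ultimately show "S \<in> {S. S \<subseteq> {1..n + 1} \<and> card S = 2 * (j + 1) \<and> central_adjacent S}"
      using parts[OF X] by (simp add: S)
  qed
  then have "card {S. S \<subseteq> {1..n + 1} \<and> card S = 2 * (j + 1) \<and> central_adjacent S} = card X"
    using \<open>inj_on F X\<close> by (simp add: card_image)
  also have "\<dots> = (\<Sum>m\<in>{1..n}. ((m - 1) choose j) * ((n - m) choose j))"
    unfolding X_def by (subst card_SigmaI) (auto simp: card_cartesian_product n_subsets)
  also have "\<dots> = n choose (2 * j + 1)"
  proof (cases n)
    case (Suc l)
    have "(\<Sum>m\<in>{1..n}. ((m - 1) choose j) * ((n - m) choose j)) = (\<Sum>m\<le>l. (m choose j) * ((l - m) choose j))"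
      unfolding Suc by (rule sum.reindex_bij_witness[of _ Suc "\<lambda>m. m - 1"]) auto
    then show ?thesis
      by (simp add: sum_choose_mult_choose Suc mult_2)
  qed simp
  finally show ?thesis .
qed

text \<open>For positive \<open>k\<close>, removing the adjacent sets from all sets of size
  \<open>2 * k\<close> is Pascal's rule; for \<open>k = 0\<close> only the empty set is
  left.\<close>

lemma card_not_central_adjacent:
  "card {S. S \<subseteq> {1..n + 1} \<and> card S = 2 * k \<and> \<not> central_adjacent S} = n choose (2 * k)"
proof (cases k)
  case 0
  have "{S. S \<subseteq> {1..n + 1} \<and> card S = 0 \<and> \<not> central_adjacent S} = {{}}"
    by (auto simp: central_adjacent_def card_eq_0_iff dest: finite_subset)
  then show ?thesis
    by (simp add: 0)
next
  case (Suc j)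
  define U where "U = {S. S \<subseteq> {1..n + 1} \<and> card S = 2 * k}"
  have finU: "finite U"
    unfolding U_def by (rule finite_subset[of _ "Pow {1..n + 1}"]) auto
  have "card U = card {S \<in> U. central_adjacent S} + card {S \<in> U. \<not> central_adjacent S}"
    using finU by (subst card_Un_disjoint[symmetric]) (auto intro!: arg_cong[of _ _ card])
  moreover have "card U = Suc n choose (2 * k)"
    unfolding U_def by (subst n_subsets) auto
  moreover have "card {S \<in> U. central_adjacent S} = n choose (2 * j + 1)"
    using card_central_adjacent[of n j] by (simp add: U_def Suc conj_assoc)
  ultimately have "card {S \<in> U. \<not> central_adjacent S} = n choose (2 * k)"
    by (simp add: Suc)
  then show ?thesis
    by (simp add: U_def conj_assoc)
qed

section \<open>Coefficients of the two covering polynomials\<close>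

lemma sum_pair_ideals: "(\<Sum>I\<in>pair_ideals n. f I) = (\<Sum>S\<in>even_subsets n. f (set_ideal n S))"
  unfolding pair_ideals_eq_image by (simp add: sum.reindex[OF inj_on_set_ideal])

lemma finite_even_subsets: "finite (even_subsets n)"
  unfolding even_subsets_def by (rule finite_subset[of _ "Pow {1..n + 1}"]) auto

lemma coeff_sum_monom_card:
  assumes "finite A"
  shows "coeff (\<Sum>x\<in>A. monom 1 (f x) :: int poly) j = int (card {x \<in> A. f x = j})"
proof -
  have "coeff (\<Sum>x\<in>A. monom 1 (f x) :: int poly) j = (\<Sum>x\<in>A. if f x = j then 1 else 0)"
    by (simp add: coeff_sum)
  also have "\<dots> = int (card {x \<in> A. f x = j})"
    using assms by (simp add: sum.If_cases Int_def)
  finally show ?thesis .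
qed

lemma coeff_sum_monom_atMost:
  "coeff (\<Sum>k\<le>N. monom (c k) k :: int poly) j = (if j \<le> N then c j else 0)"
  by (simp add: coeff_sum)

lemma coeff_K_upper_Ab: "coeff (K_upper (Ab n)) j = int ((n + 1) choose (2 * j))"
proof -
  have "K_upper (Ab n) = (\<Sum>S\<in>even_subsets n. monom 1 (card S div 2))"
    unfolding K_upper_Ab K_upper_def[of "pair_ideals n"] sum_pair_ideals
    by (simp add: kappa_set_ideal)
  then have "coeff (K_upper (Ab n)) j = int (card {S \<in> even_subsets n. card S div 2 = j})"
    by (simp add: coeff_sum_monom_card finite_even_subsets)
  also have "{S \<in> even_subsets n. card S div 2 = j} = {S. S \<subseteq> {1..n + 1} \<and> card S = 2 * j}"
    by (auto simp: even_subsets_def)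
  finally show ?thesis
    by (simp add: n_subsets)
qed

text \<open>The value \<open>j\<close> arises from size \<open>2 * (j + 1)\<close> with adjacent
  middle (\<open>U\<close>) or from size \<open>2 * (j - 1)\<close> without (\<open>V\<close>). For
  \<open>j = 0\<close> the set \<open>V\<close> must be dropped, as its truncated size would wrongly
  admit the empty set.\<close>

lemma coeff_K_lower_Ab:
  assumes "1 \<le> n"
  shows "coeff (K_lower (Ab n)) j =
    int (n choose (2 * j + 1)) + (if j = 0 then 0 else int (n choose (2 * (j - 1))))"
proof -
  define \<iota> where "\<iota> S = (if central_adjacent S then card S div 2 - 1 else card S div 2 + 1)" for S
  define U where "U = {S. S \<subseteq> {1..n + 1} \<and> card S = 2 * (j + 1) \<and> central_adjacent S}"
  define V where "V = {S. S \<subseteq> {1..n + 1} \<and> card S = 2 * (j - 1) \<and> \<not> central_adjacent S}"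
  have nonempty: "card S \<noteq> 0" if "S \<in> even_subsets n" "central_adjacent S" for S
  proof -
    have "S \<noteq> {}" "finite S"
      using that by (auto simp: central_adjacent_def elim: even_subsetsE)
    then show ?thesis
      by simp
  qed
  have "K_lower (Ab n) = (\<Sum>S\<in>even_subsets n. monom 1 (\<iota> S))"
    unfolding K_lower_Ab K_lower_def[of "pair_ideals n"] sum_pair_ideals \<iota>_def
    using assms by (simp add: iota_set_ideal)
  then have "coeff (K_lower (Ab n)) j = int (card {S \<in> even_subsets n. \<iota> S = j})"
    by (simp add: coeff_sum_monom_card finite_even_subsets)
  moreover have "{S \<in> even_subsets n. \<iota> S = j} = U \<union> (if j = 0 then {} else V)"
  proof (intro set_eqI)
    fix S
    show "S \<in> {S \<in> even_subsets n. \<iota> S = j} \<longleftrightarrow> S \<in> U \<union> (if j = 0 then {} else V)"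
      using nonempty[of S] by (auto simp: U_def V_def \<iota>_def even_subsets_def elim!: evenE)
  qed
  moreover have "finite U" "finite V" "U \<inter> V = {}"
    unfolding U_def V_def by (auto intro: finite_subset[of _ "Pow {1..n + 1}"])
  then have "card (U \<union> (if j = 0 then {} else V)) = card U + (if j = 0 then 0 else card V)"
    by (simp add: card_Un_disjoint)
  moreover have "card U = n choose (2 * j + 1)" "card V = n choose (2 * (j - 1))"
    unfolding U_def V_def by (rule card_central_adjacent card_not_central_adjacent)+
  ultimately show ?thesis
    by simp
qed

section \<open>Comparison with the binomial formulas\<close>

lemma binom_int [simp]: "binom n (int k) = int (n choose k)"
  by (simp add: binom_def)

theorem theorem5p1:
  fixes n :: nat
  assumes "n \<ge> 1"
  shows "K_upper (Ab n) = (\<Sum>k\<le>n + 1. monom (binom (n + 1) (2 * int k)) k) \<and>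
         K_lower (Ab n) =
           (\<Sum>k\<le>n + 1. monom (binom n (2 * int k + 1) + binom n (2 * int k - 2)) k) \<and>
         D_poly (Ab n) = - (\<Sum>k\<le>n + 1. monom (binom (n - 1) (2 * int k + 1)) k)"
proof (intro conjI)
  have b1: "binom m (2 * int j) = int (m choose (2 * j))" for m j
    using binom_int[of m "2 * j"] by simp
  have b2: "binom m (2 * int j + 1) = int (m choose (2 * j + 1))" for m j
    using binom_int[of m "2 * j + 1"] by (simp add: add.commute)
  \<comment> \<open>At \<open>j = 0\<close> the integer index is -2 and the value is 0, whereas the
    natural number \<open>2 * (j - 1)\<close> would give 1.\<close>
  have b3: "binom m (2 * int j - 2) = (if j = 0 then 0 else int (m choose (2 * (j - 1))))" for m j
    by (cases j) (simp_all add: binom_def nat_add_distrib nat_mult_distrib)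
  have upper: "coeff (K_upper (Ab n)) j = int ((n + 1) choose (2 * j))" for j
    by (rule coeff_K_upper_Ab)
  have lower: "coeff (K_lower (Ab n)) j =
    int (n choose (2 * j + 1)) + (if j = 0 then 0 else int (n choose (2 * (j - 1))))" for j
    by (rule coeff_K_lower_Ab[OF assms])
  \<comment> \<open>Stopping the sums at \<open>n + 1\<close> is harmless: beyond it every lower
    index exceeds the upper one.\<close>
  show "K_upper (Ab n) = (\<Sum>k\<le>n + 1. monom (binom (n + 1) (2 * int k)) k)"
    by (rule poly_eqI) (simp add: upper coeff_sum_monom_atMost b1 binomial_eq_0 del: binomial_Suc_Suc)
  show "K_lower (Ab n) = (\<Sum>k\<le>n + 1. monom (binom n (2 * int k + 1) + binom n (2 * int k - 2)) k)"
    by (rule poly_eqI) (auto simp: lower coeff_sum_monom_atMost b2 b3 binomial_eq_0)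
  define D where "D = - (\<Sum>k\<le>n + 1. monom (binom (n - 1) (2 * int k + 1)) k)"
  have coeff_D: "coeff D j = - int ((n - 1) choose (2 * j + 1))" for j
    by (simp add: D_def coeff_sum_monom_atMost b2 binomial_eq_0)
  obtain m where n: "n = Suc m"
    using assms by (cases n) auto
  \<comment> \<open>Coefficient \<open>j\<close> of the right side is
    \<open>D_j - 2 D_(j-1) + D_(j-2)\<close>, whence the split into \<open>j = 0\<close>,
    \<open>j = 1\<close> and larger \<open>j\<close>. Expanding all binomials down to upper index
    \<open>m = n - 1\<close> by Pascal's rule makes the two sides agree.\<close>
  have "K_upper (Ab n) - K_lower (Ab n) = [:-1, 1:] ^ 2 * D"
  proof (rule poly_eqI)
    fix j
    have sq: "[:-1, 1:] ^ 2 * D = pCons 0 (pCons 0 D) - smult 2 (pCons 0 D) + D"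
      by (simp add: power2_eq_square algebra_simps)
    consider "j = 0" | "j = 1" | i where "j = Suc (Suc i)"
      by (metis One_nat_def not0_implies_Suc)
    then show "coeff (K_upper (Ab n) - K_lower (Ab n)) j = coeff ([:-1, 1:] ^ 2 * D) j"
      unfolding sq
      by cases (simp_all add: upper[unfolded n] lower[unfolded n] coeff_D n coeff_pCons numeral_eq_Suc)
  qed
  then have "D_poly (Ab n) = D"
    unfolding D_poly_def using D_poly_unique_exists[OF finite_Ab] by (intro the1_equality)
  then show "D_poly (Ab n) = - (\<Sum>k\<le>n + 1. monom (binom (n - 1) (2 * int k + 1)) k)"
    by (simp add: D_def)
qed

end
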